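(* Let $\{X(t)\in\mathbb{R}^d: t\ge 0\}$ be a stationary, ergodic process with law $\mathbb{P}^*$ for each $X(t)$, such that $\mathbb{E}_{\mathbb{P}^*}\|X(t)\|_2^4<\infty$, each $X(t)$ has a density, and the following central limit property holds: for every measurable $g:\mathbb{R}^d\to\mathbb{R}^{d\times d}$ with $\sum_{i,j}|g(x)_{ij}|\le c(1+\|x\|_2^2)$ for some $c>0$, the limit $\Upsilon_g:=\lim_{n\to\infty}\mathrm{cov}_{\mathbb{P}^*}\big(n^{-1/2}\sum_{t=1}^n g(X(t))\big)$ exists and $n^{1/2}\big[\mathbb{E}_{\mathbb{P}_n}g(X)-\mathbb{E}_{\mathbb{P}^*}g(X)\big]\Rightarrow N(0,\Upsilon_g)$ as $n\to\infty$ with $d$ fixed, where $\mathbb{P}_n=\frac1n\sum_{t=1}^n\delta_{X(t)}$. Let $\boldsymbol{\Sigma}_*:=\mathbb{E}_{\mathbb{P}^*}[XX^\top]$ and assume it is invertible. Assume that the problem $$\min_{\mathbf{H}\in\mathbb{R}^{d\times d}}\ \mathbb{E}_{\mathbb{P}^*}[X^\top\mathbf{H}\mathbf{H}^\top X]\quad\text{s.t. }\mathrm{diag}(\mathbf{H})=1$$ has a unique solution $\mathbf{H}^*$. Then, with $g(x):=xx^\top$, $$n\,\mathcal{R}_n(\mathbf{H}^* )\ \lesssim_D\ \bar{\mathcal{R}}:=\sum_{i=1}^d\frac14\,Z_{\cdot i}^\top\boldsymbol{\Sigma}_*^{-1}Z_{\cdot i},$$ where $Z_{\cdot i}$ is the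 $i$-th column of a random matrix $\mathbf{Z}\sim N(0,\Upsilon_g)$.
   Context: Optimal transport cost: for Borel probability measures $\mathbb{P},\mathbb{Q}$ on $\mathbb{R}^d$, $\mathcal{D}_c(\mathbb{P},\mathbb{Q})=\inf\{\mathbb{E}_\pi\|W-U\|_2^2:\ \pi\text{ a coupling with marginals }\pi_U=\mathbb{P},\pi_W=\mathbb{Q}\}$. The Robust Wasserstein Profile function is, for $\mathbf{H}=(h_{ij})\in\mathbb{R}^{d\times d}$, $$\mathcal{R}_n(\mathbf{H}):=\inf\Big\{\mathcal{D}_c(\mathbb{P},\mathbb{P}_n):\ 1-h_{ii}=0\ (i\in[d]),\ \big(\mathbb{E}_{\mathbb{P}}[XX^\top]\mathbf{H}\big)_{ij}=0\ \text{for } i,j\in[d],\ i\neq j\Big\}.$$ For a random matrix $\mathbf{M}\in\mathbb{R}^{d\times d}$, $\mathrm{cov}(\mathbf{M})$ is the $(d\times d)\times(d\times d)$ tensor with entries $\mathrm{cov}(M_{ij},M_{kl})$; $N(0,\Upsilon)$ denotes a random $d\times d$ matrix $\mathbf{Z}$ with jointly Gaussian entries, $\mathbb{E}Z_{ij}=0$, $\mathrm{cov}(Z_{ij},Z_{kl})=\Upsilon_{ij,kl}$. "$\Rightarrow$" denotes weak convergence. The asymptotic stochastic upper bound $n\mathcal{R}_n(\mathbf{H}^* )\lesssim_D\bar{\mathcal{R}}$ means: for every continuous, bounded, non-decreasing $f:\mathbb{R}\to\mathbb{R}$, $\limsup_{n\to\infty}\mathbb{E}[f(n\mathcal{R}_n(\mathbf{H}^*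 ))]\le\mathbb{E}[f(\bar{\mathcal{R}})]$. *)

theory Defs
  imports "HOL-Probability.Probability"
begin

definition covar :: "'w measure \<Rightarrow> ('w \<Rightarrow> real) \<Rightarrow> ('w \<Rightarrow> real) \<Rightarrow> real" where
  "covar M f g = (\<integral>\<omega>. (f \<omega> - (\<integral>\<omega>'. f \<omega>' \<partial>M)) * (g \<omega> - (\<integral>\<omega>'. g \<omega>' \<partial>M)) \<partial>M)"

definition normal_law :: "real \<Rightarrow> real \<Rightarrow> real measure" where
  "normal_law m v = (if 0 < v then density lborel (\<lambda>x. ennreal (normal_density m (sqrt v) x))
                     else return borel m)"

text \<open>mu is the law of a random d x d matrix Z with jointly Gaussian entries, E Z_ij = 0,
  cov(Z_ij, Z_kl) = Ups i j k l (every linear combination of entries is centred normal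
  with the corresponding variance).\<close>
definition gaussian_matrix_law ::
  "(real^'d^'d) measure \<Rightarrow> ('d \<Rightarrow> 'd \<Rightarrow> 'd \<Rightarrow> 'd \<Rightarrow> real) \<Rightarrow> bool" where
  "gaussian_matrix_law \<mu> Ups \<longleftrightarrow> prob_space \<mu> \<and> sets \<mu> = sets borel \<and>
     (\<forall>A::real^'d^'d. distr \<mu> borel (\<lambda>z. \<Sum>i\<in>UNIV. \<Sum>j\<in>UNIV. A$i$j * z$i$j) =
        normal_law 0 (\<Sum>i\<in>UNIV. \<Sum>j\<in>UNIV. \<Sum>k\<in>UNIV. \<Sum>l\<in>UNIV. A$i$j * A$k$l * Ups i j k l))"

definition weak_conv_gen :: "(nat \<Rightarrow> 'a::metric_space measure) \<Rightarrow> 'a measure \<Rightarrow> bool" where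
  "weak_conv_gen \<mu>s \<mu> \<longleftrightarrow> (\<forall>f::'a \<Rightarrow> real. continuous_on UNIV f \<and> bounded (range f) \<longrightarrow>
       (\<lambda>n. \<integral>x. f x \<partial>(\<mu>s n)) \<longlonglongrightarrow> (\<integral>x. f x \<partial>\<mu>))"

definition stationary_proc :: "'w measure \<Rightarrow> (real \<Rightarrow> 'w \<Rightarrow> 'b::topological_space) \<Rightarrow> bool" where
  "stationary_proc M X \<longleftrightarrow> (\<forall>s\<ge>0. \<forall>J. finite J \<and> J \<subseteq> {0..} \<longrightarrow>
     distr M (PiM J (\<lambda>_. borel)) (\<lambda>\<omega>. \<lambda>t\<in>J. X (t + s) \<omega>) =
     distr M (PiM J (\<lambda>_. borel)) (\<lambda>\<omega>. \<lambda>t\<in>J. X t \<omega>))"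

definition path_shift :: "real \<Rightarrow> (real \<Rightarrow> 'b) \<Rightarrow> (real \<Rightarrow> 'b)" where
  "path_shift s f = (\<lambda>t\<in>{0..}. f (t + s))"

definition ergodic_proc :: "'w measure \<Rightarrow> (real \<Rightarrow> 'w \<Rightarrow> 'b::topological_space) \<Rightarrow> bool" where
  "ergodic_proc M X \<longleftrightarrow> (\<forall>B \<in> sets (PiM {0..} (\<lambda>_::real. (borel :: 'b measure))).
     (\<forall>s\<ge>0. \<forall>f\<in>space (PiM {0..} (\<lambda>_::real. (borel :: 'b measure))). (path_shift s f \<in> B \<longleftrightarrow> f \<in> B)) \<longrightarrow>
     measure M {\<omega>\<in>space M. (\<lambda>t\<in>{0..}. X t \<omega>) \<in> B} = 0 \<or>
     measure M {\<omega>\<in>space M. (\<lambda>t\<in>{0..}. X t \<omega>) \<in> B} = 1)"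

definition empirical :: "nat \<Rightarrow> (real \<Rightarrow> 'w \<Rightarrow> 'b::topological_space) \<Rightarrow> 'w \<Rightarrow> 'b measure" where
  "empirical n X \<omega> = distr (uniform_count_measure {1..n}) borel (\<lambda>t. X (real t) \<omega>)"

definition ot_cost :: "(real^'d) measure \<Rightarrow> (real^'d) measure \<Rightarrow> ennreal" where
  "ot_cost P Q = (INF \<pi> \<in> {\<pi>. prob_space \<pi> \<and> sets \<pi> = sets (borel \<Otimes>\<^sub>M borel) \<and>
        distr \<pi> borel fst = P \<and> distr \<pi> borel snd = Q}.
      \<integral>\<^sup>+p. ennreal ((norm (snd p - fst p))\<^sup>2) \<partial>\<pi>)"

definition second_moment :: "(real^'d) measure \<Rightarrow> real^'d^'d" where
  "second_moment P = (\<chi> i j. \<integral>x. x$i * x$j \<partial>P)"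

definition RWP :: "nat \<Rightarrow> (real \<Rightarrow> 'w \<Rightarrow> real^'d) \<Rightarrow> 'w \<Rightarrow> real^'d^'d \<Rightarrow> ennreal" where
  "RWP n X \<omega> H = (INF P \<in> {P. prob_space P \<and> sets P = sets borel \<and>
        (\<forall>i. 1 - H$i$i = 0) \<and> (\<forall>i j. integrable P (\<lambda>x. x$i * x$j)) \<and>
        (\<forall>i j. i \<noteq> j \<longrightarrow> (second_moment P ** H)$i$j = 0)}.
      ot_cost P (empirical n X \<omega>))"

text \<open>Extension of a bounded non-decreasing f to [0,infinity] (value sup f at infinity).\<close>
definition ext_enn :: "(real \<Rightarrow> real) \<Rightarrow> ennreal \<Rightarrow> real" where
  "ext_enn f x = (if x = \<infinity> then (SUP y. f y) else f (enn2real x))"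

definition clt_stat :: "nat \<Rightarrow> (real^'d \<Rightarrow> real^'d^'d) \<Rightarrow> (real \<Rightarrow> 'w \<Rightarrow> real^'d) \<Rightarrow> 'w \<Rightarrow> real^'d^'d" where
  "clt_stat n g X \<omega> = (1 / sqrt (real n)) *\<^sub>R (\<Sum>t\<in>{1..n}. g (X (real t) \<omega>))"

definition clt_cov :: "'w measure \<Rightarrow> (real \<Rightarrow> 'w \<Rightarrow> real^'d) \<Rightarrow> (real^'d \<Rightarrow> real^'d^'d)
    \<Rightarrow> 'd \<Rightarrow> 'd \<Rightarrow> 'd \<Rightarrow> 'd \<Rightarrow> real" where
  "clt_cov M X g i j k l =
     lim (\<lambda>n. covar M (\<lambda>\<omega>. clt_stat n g X \<omega> $i$j) (\<lambda>\<omega>. clt_stat n g X \<omega> $k$l))"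

definition growth_bounded :: "(real^'d \<Rightarrow> real^'d^'d) \<Rightarrow> bool" where
  "growth_bounded g \<longleftrightarrow> (\<exists>c>0. \<forall>x. (\<Sum>i\<in>UNIV. \<Sum>j\<in>UNIV. \<bar>g x $i$j\<bar>) \<le> c * (1 + (norm x)\<^sup>2))"

definition clt_property :: "'w measure \<Rightarrow> (real \<Rightarrow> 'w \<Rightarrow> real^'d) \<Rightarrow> (real^'d) measure \<Rightarrow> bool" where
  "clt_property M X Pstar \<longleftrightarrow> (\<forall>g::real^'d \<Rightarrow> real^'d^'d. g \<in> borel_measurable borel \<and> growth_bounded g \<longrightarrow>
     (\<forall>i j k l. convergent (\<lambda>n. covar M (\<lambda>\<omega>. clt_stat n g X \<omega> $i$j) (\<lambda>\<omega>. clt_stat n g X \<omega> $k$l))) \<and>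
     (\<exists>\<mu>. gaussian_matrix_law \<mu> (clt_cov M X g) \<and>
        weak_conv_gen (\<lambda>n. distr M borel (\<lambda>\<omega>. sqrt (real n) *\<^sub>R
             ((1 / real n) *\<^sub>R (\<Sum>t\<in>{1..n}. g (X (real t) \<omega>)) - (\<integral>x. g x \<partial>Pstar)))) \<mu>))"

definition lsq_obj :: "(real^'d) measure \<Rightarrow> real^'d^'d \<Rightarrow> real" where
  "lsq_obj P H = (\<integral>x. x \<bullet> ((H ** transpose H) *v x) \<partial>P)"

end

theory Submission
  imports Defs
begin

text \<open>First-order optimality makes $\Sigma_* H^*$ diagonal, so every law with second moment
  $\Sigma_*$ is feasible. If $S$ is the empirical second moment, the empirical measure is pushed
  onto such a law by $x \mapsto x + B^T x$, where $(I+B)^T S (I+B) = \Sigma_*$. To first order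
  $B = -\frac12\Sigma_*^{-1}\Delta$ with $\Delta = S - \Sigma_*$, and the cost
  $\mathrm{tr}(B^T S B)$ is $\frac14\mathrm{tr}(\Delta\Sigma_*^{-1}\Delta) + O(\|\Delta\|^3)$.
  Multiplying by $n$ and using the central limit property for $x x^T$ gives the bound. The law of
  $Z$ is identified with the weak limit through its characteristic function. The profile function
  has open strict sublevel sets as a function of the sample points, hence is a random variable.\<close>

subsection \<open>Uniqueness of Gaussian laws on matrices\<close>

text \<open>The congruence equation leaves an orthogonal factor of \<open>I + B\<close> free. It is
  fixed by asking that \<open>\<Sigma> ** B\<close> be symmetric, not \<open>B\<close> itself: the
  linearised equation \<open>\<Sigma> B + B^T \<Sigma> = -\<Delta>\<close> becomes
  \<open>2 \<Sigma> B = -\<Delta>\<close>, solved by one inverse, and its cost is exactly the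
  quadratic form of the limit.

  Such a \<open>B\<close> is available only where the empirical second moment is close to
  \<open>\<Sigma>\<close>. On the remaining event only the bound on \<open>f\<close> can be used,
  through a continuous cutoff that is removed after the limit in \<open>n\<close>.

  Measurability is a real obstacle: the profile is an infimum over uncountably many laws and
  couplings, and the Bochner integral of a nonmeasurable function is 0 by convention, so a pointwise
  bound alone would say nothing about expectations.

  The central limit property supplies some Gaussian limit law, whereas the theorem speaks of any
  \<open>Z\<close> with the right covariance; uniqueness of Gaussian laws closes this gap.\<close>

lemma weighted_marginal_char:
  fixes w Y :: "'a \<Rightarrow> real"
  assumes "finite_measure \<mu>"
    and w[measurable]: "w \<in> borel_measurable \<mu>" and Y[measurable]: "Y \<in> borel_measurable \<mu>"
    and w0: "\<And>x. 0 \<le> w x" and wC: "\<And>x. w x \<le> C" and m: "(\<integral>x. w x \<partial>\<mu>) = m" "m > 0"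
  defines "D \<equiv> distr (density \<mu> (\<lambda>x. ennreal (w x / m))) borel Y"
  shows "real_distribution D"
    and "char D t = Complex ((\<integral>x. cos (t * Y x + 0) * w x \<partial>\<mu>) / m)
                            ((\<integral>x. cos (t * Y x + (- (pi/2))) * w x \<partial>\<mu>) / m)"
    and "B \<in> sets borel \<Longrightarrow> measure D B = (\<integral>x. w x * indicator B (Y x) \<partial>\<mu>) / m"
proof -
  interpret finite_measure \<mu> by fact
  have Y': "Y \<in> borel_measurable (density \<mu> (\<lambda>x. ennreal (w x / m)))"
    by simp
  have bd: "integrable \<mu> (\<lambda>x. w x * g x)" if [measurable]: "g \<in> borel_measurable \<mu>" and "\<And>x. norm (g x) \<le> 1" for g :: "_ \<Rightarrow> real"
  proof (rule integrable_const_bound[where B = C])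
    show "AE x in \<mu>. norm (w x * g x) \<le> C"
    proof (rule AE_I2)
      fix x
      have "norm (w x * g x) \<le> w x * 1"
        using mult_left_mono[OF that(2) w0, of x x] w0[of x] by (simp add: abs_mult)
      with wC[of x] show "norm (w x * g x) \<le> C" by simp
    qed
  qed simp
  have wi: "integrable \<mu> w"
    using bd[of "\<lambda>_. 1"] by simp
  have "prob_space (density \<mu> (\<lambda>x. ennreal (w x / m)))"
  proof (rule prob_spaceI)
    have "emeasure (density \<mu> (\<lambda>x. ennreal (w x / m))) (space \<mu>) = (\<integral>\<^sup>+x. ennreal (w x / m) \<partial>\<mu>)"
      by (subst emeasure_density) (auto intro!: nn_integral_cong)
    also have "\<dots> = ennreal (\<integral>x. w x / m \<partial>\<mu>)"
      using wi w0 m by (intro nn_integral_eq_integral) auto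
    also have "\<dots> = 1" using m by simp
    finally show "emeasure (density \<mu> (\<lambda>x. ennreal (w x / m))) (space (density \<mu> (\<lambda>x. ennreal (w x / m)))) = 1"
      by simp
  qed
  then have "prob_space D" unfolding D_def by (rule prob_space.prob_space_distr) simp
  then show rd: "real_distribution D"
    by (auto simp: real_distribution_def real_distribution_axioms_def D_def)
  interpret D: real_distribution D by (rule rd)
  have real_int: "(\<integral>x. g x \<partial>D) = (\<integral>x. g (Y x) * w x \<partial>\<mu>) / m"
    if [measurable]: "g \<in> borel_measurable borel" for g :: "real \<Rightarrow> real"
  proof -
    have "(\<integral>x. g x \<partial>D) = (\<integral>x. g (Y x) \<partial>density \<mu> (\<lambda>x. ennreal (w x / m)))"
      unfolding D_def by (rule integral_distr) (use Y' in auto)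
    also have "\<dots> = (\<integral>x. (w x / m) *\<^sub>R g (Y x) \<partial>\<mu>)"
      by (rule integral_density) (use w0 m in auto)
    also have "\<dots> = (\<integral>x. (g (Y x) * w x) / m \<partial>\<mu>)"
      by (simp add: mult.commute)
    finally show ?thesis by simp
  qed
  have ii: "integrable D (\<lambda>x. iexp (t * x))"
    by (rule D.integrable_iexp) auto
  have "Re (char D t) = (\<integral>x. cos (t * x) \<partial>D)"
    unfolding char_def using ii by (subst integral_Re[symmetric]) (auto simp: Re_exp)
  moreover have "Im (char D t) = (\<integral>x. sin (t * x) \<partial>D)"
    unfolding char_def using ii by (subst integral_Im[symmetric]) (auto simp: Im_exp)
  \<comment> \<open>Phase 0 yields the real part; phase \<open>-pi/2\<close> turns the cosine into a
    sine and yields the imaginary part. One family of real integrals thus carries the whole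
    characteristic function.\<close>
  ultimately show "char D t = Complex ((\<integral>x. cos (t * Y x + 0) * w x \<partial>\<mu>) / m)
                            ((\<integral>x. cos (t * Y x + (- (pi/2))) * w x \<partial>\<mu>) / m)"
    by (intro complex_eqI) (auto simp: real_int cos_diff)
  show "measure D B = (\<integral>x. w x * indicator B (Y x) \<partial>\<mu>) / m" if [measurable]: "B \<in> sets borel"
    using real_int[of "indicator B"] by (simp add: mult.commute D.emeasure_eq_measure)
qed

text \<open>Divided by its mass, \<open>w\<close> becomes a probability density, and the
  trigonometric integrals become the characteristic function of \<open>Y\<close> under it, so Levy
  uniqueness on the line applies. Frequency and phase 0 show that both masses agree.\<close>

lemma weighted_marginal_unique:
  fixes w Y :: "'a \<Rightarrow> real"
  assumes "finite_measure \<mu>" "finite_measure \<nu>"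
    and w: "w \<in> borel_measurable \<mu>" "w \<in> borel_measurable \<nu>"
    and Y: "Y \<in> borel_measurable \<mu>" "Y \<in> borel_measurable \<nu>"
    and w0: "\<And>x. 0 \<le> w x" and wC: "\<And>x. w x \<le> C"
    and eq: "\<And>t \<phi>. (\<integral>x. cos (t * Y x + \<phi>) * w x \<partial>\<mu>) = (\<integral>x. cos (t * Y x + \<phi>) * w x \<partial>\<nu>)"
    and B: "B \<in> sets borel"
  shows "(\<integral>x. w x * indicator B (Y x) \<partial>\<mu>) = (\<integral>x. w x * indicator B (Y x) \<partial>\<nu>)"
proof -
  define m where "m = (\<integral>x. w x \<partial>\<mu>)"
  have m\<nu>: "m = (\<integral>x. w x \<partial>\<nu>)" using eq[of 0 0] by (simp add: m_def)
  have "m \<ge> 0" unfolding m_def using w0 by simp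
  show ?thesis
  proof (cases "m = 0")
    \<comment> \<open>A weight of mass zero cannot be normalised; both integrals are then squeezed
      between 0 and that mass.\<close>
    case True
    have "(\<integral>x. w x * indicator B (Y x) \<partial>\<rho>) = 0"
      if "finite_measure \<rho>" and [measurable]: "w \<in> borel_measurable \<rho>" "Y \<in> borel_measurable \<rho>" and "(\<integral>x. w x \<partial>\<rho>) = 0" for \<rho>
    proof -
      interpret finite_measure \<rho> by fact
      have "integrable \<rho> w"
        using w0 wC by (intro integrable_const_bound[where B = C]) auto
      moreover have "w x * indicator B (Y x) \<le> w x" for x
        using w0[of x] by (auto simp: indicator_def)
      ultimately have "(\<integral>x. w x * indicator B (Y x) \<partial>\<rho>) \<le> (\<integral>x. w x \<partial>\<rho>)"
        using w0 by (intro integral_mono') auto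
      moreover have "0 \<le> (\<integral>x. w x * indicator B (Y x) \<partial>\<rho>)"
        using w0 by (intro integral_nonneg_AE) auto
      ultimately show ?thesis using that by simp
    qed
    then show ?thesis using assms m_def m\<nu> True by metis
  next
    case False
    with \<open>m \<ge> 0\<close> have "m > 0" by simp
    note wm\<mu> = weighted_marginal_char[OF assms(1) w(1) Y(1) w0 wC m_def[symmetric] \<open>m > 0\<close>]
    note wm\<nu> = weighted_marginal_char[OF assms(2) w(2) Y(2) w0 wC m\<nu>[symmetric] \<open>m > 0\<close>]
    have "distr (density \<mu> (\<lambda>x. ennreal (w x / m))) borel Y = distr (density \<nu> (\<lambda>x. ennreal (w x / m))) borel Y"
      by (rule Levy_uniqueness[OF wm\<mu>(1) wm\<nu>(1)]) (simp only: fun_eq_iff wm\<mu>(2) wm\<nu>(2) eq simp_thms)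
    with wm\<mu>(3)[OF B] wm\<nu>(3)[OF B] \<open>m > 0\<close> show ?thesis by simp
  qed
qed

text \<open>Coordinates are passed one at a time from the phase to the indicator; the factor
  $1 + \cos$ turns a trigonometric weight into a positive one, so that the one-dimensional
  uniqueness theorem applies.\<close>
lemma trig_box_integral_eq:
  fixes \<mu> \<nu> :: "'a::euclidean_space measure"
  assumes "finite_measure \<mu>" "finite_measure \<nu>" "sets \<mu> = sets borel" "sets \<nu> = sets borel"
    and eq: "\<And>a \<phi>. (\<integral>x. cos (a \<bullet> x + \<phi>) \<partial>\<mu>) = (\<integral>x. cos (a \<bullet> x + \<phi>) \<partial>\<nu>)"
    and "finite J" and "\<And>i. B i \<in> sets borel"
  shows "(\<integral>x. cos (a \<bullet> x + \<phi>) * (\<Prod>i\<in>J. indicator (B i) (i \<bullet> x)) \<partial>\<mu>)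
       = (\<integral>x. cos (a \<bullet> x + \<phi>) * (\<Prod>i\<in>J. indicator (B i) (i \<bullet> x)) \<partial>\<nu>)"
  using \<open>finite J\<close>
proof (induction J arbitrary: a \<phi>)
  case empty
  then show ?case by (simp add: eq)
next
  case (insert j J)
  note [measurable_cong] = assms(3,4) and [measurable] = assms(7)
  define p :: "'a \<Rightarrow> real" where "p x = (\<Prod>i\<in>J. indicator (B i) (i \<bullet> x))" for x
  have p_meas[measurable]: "p \<in> borel_measurable borel"
    unfolding p_def by measurable
  have p01: "0 \<le> p x" "p x \<le> 1" for x
    unfolding p_def by (auto intro!: prod_nonneg prod_le_1)
  have int: "integrable \<rho> (\<lambda>x. cos (a \<bullet> x + \<phi>) * p x)" "integrable \<rho> (\<lambda>x. cos (a \<bullet> x + \<phi>) * (p x * indicator (B j) (j \<bullet> x)))"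
      "integrable \<rho> (\<lambda>x. p x * indicator (B j) (j \<bullet> x))"
    if "finite_measure \<rho>" and [measurable_cong]: "sets \<rho> = sets borel" for \<rho> a \<phi>
  proof -
    interpret finite_measure \<rho> by fact
    have 1: "\<bar>cos (a \<bullet> x + \<phi>) * p x\<bar> \<le> 1" for x
      using p01[of x] mult_mono[of "\<bar>cos (a \<bullet> x + \<phi>)\<bar>" 1 "p x" 1] by (simp add: abs_mult)
    show "integrable \<rho> (\<lambda>x. cos (a \<bullet> x + \<phi>) * p x)"
      using 1 by (intro integrable_const_bound[where B = 1]) auto
    show "integrable \<rho> (\<lambda>x. cos (a \<bullet> x + \<phi>) * (p x * indicator (B j) (j \<bullet> x)))"
      using 1 by (intro integrable_const_bound[where B = 1]) (auto simp: indicator_def)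
    show "integrable \<rho> (\<lambda>x. p x * indicator (B j) (j \<bullet> x))"
      using p01 by (intro integrable_const_bound[where B = 1]) (auto simp: indicator_def)
  qed
  have IH: "(\<integral>x. cos (a \<bullet> x + \<phi>) * p x \<partial>\<mu>) = (\<integral>x. cos (a \<bullet> x + \<phi>) * p x \<partial>\<nu>)" for a \<phi>
    unfolding p_def by (rule insert.IH)
  have key: "(\<integral>x. (1 + cos (a \<bullet> x + \<theta>)) * p x * indicator (B j) (j \<bullet> x) \<partial>\<mu>)
        = (\<integral>x. (1 + cos (a \<bullet> x + \<theta>)) * p x * indicator (B j) (j \<bullet> x) \<partial>\<nu>)" for a \<theta>
  proof (rule weighted_marginal_unique[where C = 2])
    fix x
    have c: "0 \<le> 1 + cos (a \<bullet> x + \<theta>)" "1 + cos (a \<bullet> x + \<theta>) \<le> 2"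
      using cos_ge_minus_one[of "a \<bullet> x + \<theta>"] by (auto simp del: cos_ge_minus_one)
    then show "0 \<le> (1 + cos (a \<bullet> x + \<theta>)) * p x" using p01[of x] by simp
    show "(1 + cos (a \<bullet> x + \<theta>)) * p x \<le> 2"
      using mult_mono[OF c(2) p01(2)[of x]] c p01[of x] by simp
  next
    fix t \<phi>
    \<comment> \<open>Product-to-sum: the new cosine in \<open>j \<bullet> x\<close> merges with the
      old one into frequencies \<open>a + t j\<close> and \<open>a - t j\<close>. The induction
      hypothesis covers these because frequency and phase are kept arbitrary.\<close>
    have e: "cos (t * (j \<bullet> x) + \<phi>) * ((1 + cos (a \<bullet> x + \<theta>)) * p x) =
       cos ((t *\<^sub>R j) \<bullet> x + \<phi>) * p x + (1/2) * (cos ((a + t *\<^sub>R j) \<bullet> x + (\<theta> + \<phi>)) * p x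
         + cos ((a - t *\<^sub>R j) \<bullet> x + (\<theta> - \<phi>)) * p x)" for x
    proof -
      have "(a + t *\<^sub>R j) \<bullet> x + (\<theta> + \<phi>) = (a \<bullet> x + \<theta>) + (t * (j \<bullet> x) + \<phi>)"
        "(a - t *\<^sub>R j) \<bullet> x + (\<theta> - \<phi>) = (a \<bullet> x + \<theta>) - (t * (j \<bullet> x) + \<phi>)"
        by (auto simp: algebra_simps)
      then show ?thesis
        by (simp only: cos_add[of "a \<bullet> x + \<theta>"] cos_diff[of "a \<bullet> x + \<theta>"] inner_scaleR_left) (simp add: algebra_simps)
    qed
    show "(\<integral>x. cos (t * (j \<bullet> x) + \<phi>) * ((1 + cos (a \<bullet> x + \<theta>)) * p x) \<partial>\<mu>) =
          (\<integral>x. cos (t * (j \<bullet> x) + \<phi>) * ((1 + cos (a \<bullet> x + \<theta>)) * p x) \<partial>\<nu>)"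
      unfolding e using int(1)[OF assms(1,3)] int(1)[OF assms(2,4)]
      by (simp only: IH Bochner_Integration.integral_add Bochner_Integration.integrable_add
          integrable_mult_right integral_mult_right_zero)
  qed (use assms in auto)
  \<comment> \<open>At frequency 0 and phase \<open>pi/2\<close> the cosine vanishes. What remains
    is the contribution of the summand 1 in \<open>1 + cos\<close>, to be subtracted below.\<close>
  have key0: "(\<integral>x. p x * indicator (B j) (j \<bullet> x) \<partial>\<mu>) = (\<integral>x. p x * indicator (B j) (j \<bullet> x) \<partial>\<nu>)"
    using key[of 0 "pi/2"] by simp
  have split: "(\<integral>x. (1 + cos (a \<bullet> x + \<phi>)) * p x * indicator (B j) (j \<bullet> x) \<partial>\<rho>) =
      (\<integral>x. p x * indicator (B j) (j \<bullet> x) \<partial>\<rho>) + (\<integral>x. cos (a \<bullet> x + \<phi>) * (p x * indicator (B j) (j \<bullet> x)) \<partial>\<rho>)"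
    if "finite_measure \<rho>" "sets \<rho> = sets borel" for \<rho>
    using int(2,3)[OF that] by (subst Bochner_Integration.integral_add[symmetric]) (auto simp: algebra_simps)
  have "(\<integral>x. cos (a \<bullet> x + \<phi>) * (p x * indicator (B j) (j \<bullet> x)) \<partial>\<mu>) = (\<integral>x. cos (a \<bullet> x + \<phi>) * (p x * indicator (B j) (j \<bullet> x)) \<partial>\<nu>)"
    using key[of a \<phi>] key0 split[OF assms(1,3)] split[OF assms(2,4)] by simp
  then show ?case
    using insert.hyps by (simp add: p_def mult.commute)
qed

text \<open>Levy uniqueness in several dimensions, with real cosines as characters. Once every
  coordinate sits in an indicator, frequency and phase 0 leave the measure of an open box, and boxes
  are an intersection-stable generator of the Borel sets.\<close>

lemma finite_measure_eqI_trig: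
  fixes \<mu> \<nu> :: "'a::euclidean_space measure"
  assumes "finite_measure \<mu>" "finite_measure \<nu>" "sets \<mu> = sets borel" "sets \<nu> = sets borel"
    and eq: "\<And>a \<phi>. (\<integral>x. cos (a \<bullet> x + \<phi>) \<partial>\<mu>) = (\<integral>x. cos (a \<bullet> x + \<phi>) \<partial>\<nu>)"
  shows "\<mu> = \<nu>"
proof -
  interpret \<mu>: finite_measure \<mu> by fact
  interpret \<nu>: finite_measure \<nu> by fact
  note [measurable_cong] = assms(3,4)
  have ind: "(\<Prod>i\<in>Basis. indicator {a \<bullet> i<..<b \<bullet> i} (i \<bullet> x)) = (indicator (box a b) x :: real)" for a b x :: 'a
    by (auto simp: indicator_def box_def inner_commute)
  have "measure \<mu> (box a b) = measure \<nu> (box a b)" for a b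
    using trig_box_integral_eq[OF assms finite_Basis, of "\<lambda>i. {a \<bullet> i<..<b \<bullet> i}" 0 0]
    by (simp add: ind assms sets_eq_imp_space_eq[OF assms(3)] sets_eq_imp_space_eq[OF assms(4)])
  then have emb: "emeasure \<mu> (box a b) = emeasure \<nu> (box a b)" for a b
    by (simp add: \<mu>.emeasure_eq_measure \<nu>.emeasure_eq_measure)
  show ?thesis
  proof (rule measure_eqI_generator_eq)
    let ?E = "range (\<lambda>(a, b). box a b :: 'a set)"
    have "box a b \<inter> box c d \<in> ?E" for a b c d :: 'a
      unfolding box_Int_box by auto
    then show "Int_stable ?E" by (auto simp: Int_stable_def)
    show "?E \<subseteq> Pow UNIV" by simp
    show "sets \<mu> = sigma_sets UNIV ?E" "sets \<nu> = sigma_sets UNIV ?E"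
      using assms(3,4) by (simp_all add: borel_eq_box)
    show "range (\<lambda>n. box (- (real n *\<^sub>R One)) (real n *\<^sub>R One)) \<subseteq> ?E" by auto
    show "(\<Union>n. box (- (real n *\<^sub>R One)) (real n *\<^sub>R One)) = (UNIV :: 'a set)"
      by (rule UN_box_eq_UNIV)
    show "emeasure \<mu> A = emeasure \<nu> A" if "A \<in> ?E" for A using that emb by auto
    show "emeasure \<mu> (box (- (real n *\<^sub>R One)) (real n *\<^sub>R One)) \<noteq> \<infinity>" for n by simp
  qed
qed

text \<open>The Cramer-Wold device: \<open>gaussian_matrix_law\<close> prescribes the law of each
  Frobenius product \<open>a \<bullet> z\<close>, and the test functions
  \<open>cos (a \<bullet> z + \<phi>)\<close> depend on \<open>z\<close> only through it.\<close>

lemma gaussian_matrix_law_unique: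
  fixes \<mu> \<nu> :: "(real^'d^'d) measure"
  assumes "gaussian_matrix_law \<mu> U" "gaussian_matrix_law \<nu> U"
  shows "\<mu> = \<nu>"
proof (rule finite_measure_eqI_trig)
  show s: "sets \<mu> = sets borel" "sets \<nu> = sets borel" "finite_measure \<mu>" "finite_measure \<nu>"
    using assms by (auto simp: gaussian_matrix_law_def intro: prob_space.finite_measure)
  fix a :: "real^'d^'d" and \<phi>
  have inner: "(\<Sum>i\<in>UNIV. \<Sum>j\<in>UNIV. a$i$j * z$i$j) = a \<bullet> z" for z
    by (simp add: inner_vec_def)
  have d: "distr \<mu> borel (\<lambda>z. a \<bullet> z) = distr \<nu> borel (\<lambda>z. a \<bullet> z)"
    using assms unfolding gaussian_matrix_law_def inner[symmetric] by simp
  have "(\<integral>x. cos (a \<bullet> x + \<phi>) \<partial>\<rho>) = (\<integral>t. cos (t + \<phi>) \<partial>distr \<rho> borel (\<lambda>z. a \<bullet> z))"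
    if [measurable_cong]: "sets \<rho> = sets borel" for \<rho> :: "(real^'d^'d) measure"
    by (subst integral_distr) auto
  then show "(\<integral>x. cos (a \<bullet> x + \<phi>) \<partial>\<mu>) = (\<integral>x. cos (a \<bullet> x + \<phi>) \<partial>\<nu>)"
    using s d by simp
qed

subsection \<open>Congruence of nearby symmetric matrices\<close>

text \<open>The norm of nested vectors is the Frobenius norm; Cauchy-Schwarz is applied to each pair
  of a row and a column.\<close>

lemma norm_matrix_mult_le:
  fixes A :: "real^'n^'m" and B :: "real^'k^'n"
  shows "norm (A ** B) \<le> norm A * norm B"
proof (rule power2_le_imp_le)
  have sq: "(norm C)\<^sup>2 = (\<Sum>i\<in>UNIV. (norm (row i C))\<^sup>2)" for C :: "real^'b^'a"
    unfolding power2_norm_eq_inner inner_vec_def[of C] row_def by simp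
  have sq': "(norm C)\<^sup>2 = (\<Sum>j\<in>UNIV. (norm (column j C))\<^sup>2)" for C :: "real^'b^'a"
    unfolding power2_norm_eq_inner inner_vec_def[of C] column_def
    by (simp add: inner_vec_def) (rule sum.swap)
  have "(norm (A ** B))\<^sup>2 = (\<Sum>i\<in>UNIV. \<Sum>j\<in>UNIV. (row i A \<bullet> column j B)\<^sup>2)"
    unfolding power2_norm_eq_inner inner_vec_def[of "A ** B"]
    by (simp add: inner_vec_def matrix_matrix_mult_def row_def column_def power2_eq_square)
  also have "\<dots> \<le> (\<Sum>i\<in>UNIV. \<Sum>j\<in>UNIV. (norm (row i A))\<^sup>2 * (norm (column j B))\<^sup>2)"
    by (intro sum_mono) (metis Cauchy_Schwarz_ineq power2_norm_eq_inner)
  also have "\<dots> = (norm A * norm B)\<^sup>2"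
    unfolding power_mult_distrib sq[of A] sq'[of B] by (simp add: sum_product)
  finally show "(norm (A ** B))\<^sup>2 \<le> (norm A * norm B)\<^sup>2" .
qed simp

lemma norm_transpose: "norm (transpose A) = norm (A :: real^'n^'m)"
  unfolding norm_eq_sqrt_inner inner_vec_def transpose_def
  by (subst sum.swap) simp

lemma matrix_mult_scaleR_right: "A ** (c *\<^sub>R B) = c *\<^sub>R ((A :: real^'n^'m) ** B)"
  by (simp add: matrix_matrix_mult_def vec_eq_iff sum_distrib_left mult.left_commute)

lemma matrix_add_rdistrib: "(A + B) ** C = A ** C + (B :: real^'n^'m) ** C"
  by (simp add: matrix_matrix_mult_def vec_eq_iff sum.distrib distrib_right)

lemma transpose_add: "transpose (A + B) = transpose A + transpose (B :: real^'n^'m)"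
  by (simp add: transpose_def vec_eq_iff)

lemma continuous_on_matrix_mult [continuous_intros]:
  fixes f :: "'a::topological_space \<Rightarrow> real^'n^'m" and g :: "'a \<Rightarrow> real^'k^'n"
  assumes "continuous_on S f" "continuous_on S g"
  shows "continuous_on S (\<lambda>x. f x ** g x)"
  unfolding matrix_matrix_mult_def by (intro continuous_intros assms)

lemma continuous_on_transpose [continuous_intros]:
  fixes f :: "'a::topological_space \<Rightarrow> real^'n^'m"
  assumes "continuous_on S f"
  shows "continuous_on S (\<lambda>x. transpose (f x))"
  unfolding transpose_def by (intro continuous_intros assms)

text \<open>The congruence equation is rewritten as $B = -\frac12\Sigma^{-1}F(B)$ with $F(B)$ symmetric and
  $F(B) = \Delta + O(\|\Delta\|^2)$ on a ball of radius $O(\|\Delta\|)$, where Brouwer applies; the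
  leading term of the cost comes from $\Sigma B = -\frac12 F(B)$.\<close>
lemma congruence_correction:
  fixes \<Sigma> :: "real^'d^'d"
  assumes sym: "transpose \<Sigma> = \<Sigma>" and inv: "\<Sigma> ** \<Sigma>' = mat 1" and "\<eta> > 0"
  shows "\<exists>\<delta>>0. \<forall>S. transpose S = S \<longrightarrow> norm (S - \<Sigma>) \<le> \<delta> \<longrightarrow>
    (\<exists>B. transpose (mat 1 + B) ** S ** (mat 1 + B) = \<Sigma> \<and>
       (S ** B) \<bullet> B \<le> 1/4 * ((S - \<Sigma>) \<bullet> (\<Sigma>' ** (S - \<Sigma>))) + \<eta> * (norm (S - \<Sigma>))\<^sup>2)"
proof -
  \<comment> \<open>On the ball of radius \<open>k e\<close>, where
    \<open>e = norm (S - \<Sigma>)\<close>, \<open>c1\<close> bounds the quadratic remainder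
    \<open>G\<close> relative to the square of \<open>e\<close>, and \<open>c\<close> collects the
    cubic terms of the cost. The three minima in \<open>\<delta>\<close> give
    \<open>e \<le> 1\<close>, \<open>c1 e \<le> 1\<close> for the self-map property, and
    \<open>c e \<le> \<eta>\<close> for the final error.\<close>
  define k where "k = norm \<Sigma>' + 1"
  define c1 where "c1 = 2 * k + k\<^sup>2 * (norm \<Sigma> + 1)"
  define c where "c = 1/4 * (2 * k * c1 + k * c1\<^sup>2) + k\<^sup>2"
  define \<delta> where "\<delta> = min 1 (min (1 / c1) (\<eta> / c))"
  have k: "k \<ge> 1" "norm \<Sigma>' \<le> k" by (auto simp: k_def)
  have c1: "c1 > 0" using k unfolding c1_def by (intro add_pos_nonneg) auto
  have c: "c > 0" using k c1 unfolding c_def by (intro add_nonneg_pos) auto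
  have "\<delta> > 0" using c1 c \<open>\<eta> > 0\<close> by (simp add: \<delta>_def)
  moreover have "\<exists>B. transpose (mat 1 + B) ** S ** (mat 1 + B) = \<Sigma> \<and>
         (S ** B) \<bullet> B \<le> 1/4 * ((S - \<Sigma>) \<bullet> (\<Sigma>' ** (S - \<Sigma>))) + \<eta> * (norm (S - \<Sigma>))\<^sup>2"
    if S: "transpose S = S" and d: "norm (S - \<Sigma>) \<le> \<delta>" for S
  proof -
    define \<Delta> where "\<Delta> = S - \<Sigma>"
    define e where "e = norm \<Delta>"
    have S_eq: "S = \<Sigma> + \<Delta>" by (simp add: \<Delta>_def)
    have \<Delta>sym: "transpose \<Delta> = \<Delta>"
      using S sym by (simp add: S_eq transpose_add)
    have e0: "e \<ge> 0" and e1: "e \<le> 1" and ec1: "c1 * e \<le> 1" and ec: "c * e \<le> \<eta>"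
      using d c1 c by (auto simp: e_def \<Delta>_def \<delta>_def field_simps)
    have nS: "norm S \<le> norm \<Sigma> + 1"
      using norm_triangle_ineq[of \<Sigma> \<Delta>] e1 by (simp add: S_eq e_def)
    \<comment> \<open>Expanding the congruence gives
      \<open>\<Sigma> + F B + \<Sigma> B + B^T \<Sigma>\<close>. As \<open>F B\<close> is symmetric
      for every \<open>B\<close>, a fixed point of \<open>\<Phi>\<close> makes each of the last two
      terms equal to \<open>-1/2 F B\<close>.\<close>
    define G where "G B = \<Delta> ** B + transpose B ** \<Delta> + transpose B ** S ** B" for B :: "real^'d^'d"
    define F where "F B = \<Delta> + G B" for B
    define \<Phi> where "\<Phi> B = (- (1/2)) *\<^sub>R (\<Sigma>' ** F B)" for B
    have nG: "norm (G B) \<le> c1 * e\<^sup>2" if "norm B \<le> k * e" for B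
    proof -
      have "norm (\<Delta> ** B) \<le> e * (k * e)"
        using norm_matrix_mult_le[of \<Delta> B] mult_left_mono[OF that, of e] e0 by (simp add: e_def)
      moreover have "norm (transpose B ** \<Delta>) \<le> (k * e) * e"
        using norm_matrix_mult_le[of "transpose B" \<Delta>] mult_right_mono[OF that, of e] e0
        by (simp add: e_def norm_transpose)
      moreover have "norm (transpose B ** S ** B) \<le> (k * e) * (norm \<Sigma> + 1) * (k * e)"
      proof -
        have "norm (transpose B ** S ** B) \<le> norm B * norm S * norm B"
          using norm_matrix_mult_le[of "transpose B ** S" B] norm_matrix_mult_le[of "transpose B" S]
          by (simp add: norm_transpose) (meson mult_right_mono norm_ge_zero order_trans)
        also have "\<dots> \<le> (k * e) * (norm \<Sigma> + 1) * (k * e)"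
          using that nS k e0 by (intro mult_mono) auto
        finally show ?thesis .
      qed
      ultimately have "norm (G B) \<le> e * (k * e) + (k * e) * e + (k * e) * (norm \<Sigma> + 1) * (k * e)"
        unfolding G_def by (intro norm_triangle_le add_mono) auto
      also have "\<dots> = c1 * e\<^sup>2" by (simp add: c1_def power2_eq_square algebra_simps)
      finally show ?thesis .
    qed
    have n\<Phi>: "norm (\<Phi> B) \<le> k * e" if "norm B \<le> k * e" for B
    proof -
      have "norm (F B) \<le> e + c1 * e\<^sup>2"
        unfolding F_def using nG[OF that] by (intro norm_triangle_le) (simp add: e_def)
      \<comment> \<open>The remainder is absorbed by \<open>c1 e \<le> 1\<close>; the resulting 2
        cancels against the factor 1/2 in \<open>\<Phi>\<close>, so the radius \<open>k e\<close> is
        reproduced exactly.\<close>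
      also have "\<dots> \<le> 2 * e"
        using mult_right_mono[OF ec1 e0] by (simp add: power2_eq_square)
      finally have "norm (\<Sigma>' ** F B) \<le> k * (2 * e)"
        using norm_matrix_mult_le[of \<Sigma>' "F B"] mult_mono[OF k(2), of "norm (F B)" "2 * e"] k(1) by simp
      then show ?thesis by (simp add: \<Phi>_def)
    qed
    have "continuous_on (cball 0 (k * e)) \<Phi>"
      unfolding \<Phi>_def F_def G_def by (intro continuous_intros)
    moreover have "\<Phi> \<in> cball 0 (k * e) \<rightarrow> cball 0 (k * e)" using n\<Phi> by auto
    moreover have "cball 0 (k * e) \<noteq> ({} :: (real^'d^'d) set)"
      using mult_nonneg_nonneg[of k e] k e0 by (simp add: not_less)
    ultimately obtain B where B: "B \<in> cball 0 (k * e)" "\<Phi> B = B"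
      using brouwer[OF compact_cball convex_cball] by blast
    then have nB: "norm B \<le> k * e" by simp
    have \<Sigma>B: "\<Sigma> ** B = (- (1/2)) *\<^sub>R F B"
    proof -
      have "\<Sigma> ** B = (- (1/2)) *\<^sub>R (\<Sigma> ** \<Sigma>' ** F B)"
        by (subst B(2)[symmetric]) (simp only: \<Phi>_def matrix_mult_scaleR_right matrix_mul_assoc)
      then show ?thesis by (simp add: inv)
    qed
    have Fsym: "transpose (F B) = F B"
      by (simp add: F_def G_def transpose_add matrix_transpose_mul \<Delta>sym S matrix_mul_assoc)
    have B\<Sigma>: "transpose B ** \<Sigma> = (- (1/2)) *\<^sub>R F B"
    proof -
      have "transpose B ** \<Sigma> = transpose (\<Sigma> ** B)" by (simp add: matrix_transpose_mul sym)
      also have "\<dots> = (- (1/2)) *\<^sub>R transpose (F B)" unfolding \<Sigma>B by (simp add: transpose_def vec_eq_iff)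
      finally show ?thesis by (simp add: Fsym)
    qed
    have "transpose (mat 1 + B) ** S ** (mat 1 + B) = \<Sigma> + F B + \<Sigma> ** B + transpose B ** \<Sigma>"
      by (simp add: F_def G_def S_eq transpose_add transpose_mat matrix_add_ldistrib matrix_add_rdistrib algebra_simps)
    also have "\<dots> = \<Sigma>"
      unfolding \<Sigma>B B\<Sigma> by (simp add: vec_eq_iff)
    finally have congr: "transpose (mat 1 + B) ** S ** (mat 1 + B) = \<Sigma>" .
    have ip: "P \<bullet> (\<Sigma>' ** Q) \<le> norm P * (k * norm Q)" for P Q
    proof -
      have "P \<bullet> (\<Sigma>' ** Q) \<le> norm P * norm (\<Sigma>' ** Q)" by (rule norm_cauchy_schwarz)
      also have "\<dots> \<le> norm P * (k * norm Q)"
        using norm_matrix_mult_le[of \<Sigma>' Q] mult_right_mono[OF k(2), of "norm Q"] by (intro mult_left_mono) auto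
      finally show ?thesis .
    qed
    let ?g = "norm (G B)"
    have g: "?g \<le> c1 * e\<^sup>2" using nG[OF nB] .
    have "(S ** B) \<bullet> B = (\<Sigma> ** B) \<bullet> B + (\<Delta> ** B) \<bullet> B"
      by (simp add: S_eq matrix_add_rdistrib inner_add_left)
    \<comment> \<open>Origin of the constant 1/4: both \<open>\<Sigma> ** B\<close> and
      \<open>B = \<Phi> B\<close> carry a factor \<open>-1/2\<close>.\<close>
    also have "(\<Sigma> ** B) \<bullet> B = 1/4 * (F B \<bullet> (\<Sigma>' ** F B))"
    proof -
      have "(\<Sigma> ** B) \<bullet> B = ((- (1/2)) *\<^sub>R F B) \<bullet> \<Phi> B" by (simp add: \<Sigma>B B(2))
      then show ?thesis by (simp add: \<Phi>_def)
    qed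
    also have "F B \<bullet> (\<Sigma>' ** F B) = \<Delta> \<bullet> (\<Sigma>' ** \<Delta>) + \<Delta> \<bullet> (\<Sigma>' ** G B) + G B \<bullet> (\<Sigma>' ** \<Delta>) + G B \<bullet> (\<Sigma>' ** G B)"
      by (simp add: F_def matrix_add_ldistrib inner_add_left inner_add_right)
    also have "\<dots> \<le> \<Delta> \<bullet> (\<Sigma>' ** \<Delta>) + (2 * k * c1 + k * c1\<^sup>2) * e ^ 3"
    proof -
      have "\<Delta> \<bullet> (\<Sigma>' ** G B) \<le> e * (k * (c1 * e\<^sup>2))"
        by (rule order_trans[OF ip]) (use g k e0 in \<open>simp add: e_def mult_left_mono\<close>)
      moreover have "G B \<bullet> (\<Sigma>' ** \<Delta>) \<le> (c1 * e\<^sup>2) * (k * e)"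
        by (rule order_trans[OF ip], unfold e_def[symmetric], rule mult_right_mono[OF g]) (use k e0 in simp)
      moreover have "G B \<bullet> (\<Sigma>' ** G B) \<le> (c1 * e\<^sup>2) * (k * (c1 * e\<^sup>2))"
        by (rule order_trans[OF ip], intro mult_mono g) (use k c1 in auto)
      moreover have "(c1 * e\<^sup>2) * (k * (c1 * e\<^sup>2)) \<le> (k * c1\<^sup>2) * e ^ 3"
      proof -
        have "e ^ 4 \<le> e ^ 3" using e0 e1 by (intro power_decreasing) auto
        then have "(k * c1\<^sup>2) * e ^ 4 \<le> (k * c1\<^sup>2) * e ^ 3" using k by (intro mult_left_mono) auto
        then show ?thesis by (simp add: power2_eq_square power3_eq_cube power4_eq_xxxx algebra_simps)
      qed
      ultimately show ?thesis by (simp add: power2_eq_square power3_eq_cube algebra_simps)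
    qed
    also have "(\<Delta> ** B) \<bullet> B \<le> k\<^sup>2 * e ^ 3"
    proof -
      have "(\<Delta> ** B) \<bullet> B \<le> norm (\<Delta> ** B) * norm B" by (rule norm_cauchy_schwarz)
      also have "\<dots> \<le> (e * (k * e)) * (k * e)"
        using norm_matrix_mult_le[of \<Delta> B] mult_left_mono[OF nB, of e] e0 k nB
        by (intro mult_mono) (auto simp: e_def)
      finally show ?thesis by (simp add: power2_eq_square power3_eq_cube algebra_simps)
    qed
    finally have "(S ** B) \<bullet> B \<le> 1/4 * (\<Delta> \<bullet> (\<Sigma>' ** \<Delta>)) + c * e ^ 3"
      by (simp add: c_def algebra_simps)
    also have "c * e ^ 3 \<le> \<eta> * e\<^sup>2"
      using mult_right_mono[OF ec, of "e\<^sup>2"] by (simp add: power2_eq_square power3_eq_cube algebra_simps)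
    finally show ?thesis using congr by (auto simp: \<Delta>_def e_def)
  qed
  ultimately show ?thesis by blast
qed

subsection \<open>Measurability of the profile function\<close>

lemma emeasure_distr_uniform_count:
  fixes x :: "nat \<Rightarrow> 'a::topological_space"
  assumes "A \<in> sets borel"
  shows "emeasure (distr (uniform_count_measure {1..n}) borel x) A =
    ennreal (card {t\<in>{1..n}. x t \<in> A} / n)"
proof -
  have m: "x \<in> measurable (uniform_count_measure {1..n}) borel"
    by (subst measurable_cong_sets[OF sets_uniform_count_measure_count_space refl]) simp
  have "x -` A \<inter> {1..n} = {t\<in>{1..n}. x t \<in> A}" by auto
  moreover have "emeasure (uniform_count_measure {1..n}) {t\<in>{1..n}. x t \<in> A} = ennreal (card {t\<in>{1..n}. x t \<in> A} / n)"
    by (subst emeasure_uniform_count_measure) auto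
  ultimately show ?thesis
    using assms by (subst emeasure_distr[OF m]) (simp_all only: space_uniform_count_measure)
qed

text \<open>If the second marginal of a coupling is the empirical measure of \<open>x\<close>, each atom \<open>x t\<close>
  is split evenly among the indices it represents, and index \<open>t\<close> is then sent to \<open>y t\<close>.\<close>
lemma coupling_move_atoms:
  fixes x y :: "nat \<Rightarrow> 'a::euclidean_space" and \<pi> :: "('a \<times> 'a) measure"
  assumes "prob_space \<pi>" and sets_\<pi>[measurable_cong]: "sets \<pi> = sets (borel \<Otimes>\<^sub>M borel)"
    and fst: "distr \<pi> borel fst = P"
    and snd: "distr \<pi> borel snd = distr (uniform_count_measure {1..n}) borel x"
    and "n > 0" and r: "\<And>t. t \<in> {1..n} \<Longrightarrow> dist (x t) (y t) \<le> r" and "r \<ge> 0"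
  obtains \<pi>' where "prob_space \<pi>'" "sets \<pi>' = sets (borel \<Otimes>\<^sub>M borel)"
    "distr \<pi>' borel fst = P" "distr \<pi>' borel snd = distr (uniform_count_measure {1..n}) borel y"
    "(\<integral>\<^sup>+p. ennreal ((norm (snd p - fst p))\<^sup>2) \<partial>\<pi>')
       \<le> ennreal (1 + r) * (\<integral>\<^sup>+p. ennreal ((norm (snd p - fst p))\<^sup>2) \<partial>\<pi>) + ennreal (r + r\<^sup>2)"
proof -
  interpret \<pi>: prob_space \<pi> by fact
  define m where "m u = card {t\<in>{1..n}. x t = u}" for u
  define k where "k p t = (if snd p = x t then ennreal (1 / m (x t)) else 0)" for p :: "'a \<times> 'a" and t
  define C where "C = (count_space {1..n} :: nat measure)"
  have setsC[measurable_cong]: "sets C = sets (count_space {1..n})" by (simp add: C_def)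
  have k_t[measurable]: "(\<lambda>p. k p t) \<in> borel_measurable \<pi>" for t
    unfolding k_def by measurable
  have k_meas[measurable]: "(\<lambda>q. k (snd q) (fst q)) \<in> borel_measurable (C \<Otimes>\<^sub>M \<pi>)"
    unfolding C_def by (rule measurable_pair_measure_countable1) auto
  have y_meas[measurable]: "(\<lambda>q. (fst (snd q), y (fst q))) \<in> measurable (C \<Otimes>\<^sub>M \<pi>) (borel \<Otimes>\<^sub>M borel)"
    unfolding C_def by (rule measurable_pair_measure_countable1) auto
  \<comment> \<open>\<open>\<kappa>\<close> is the joint law of index and coupled pair. Its image
    \<open>\<pi>'\<close> keeps the first point and replaces the second by the target of the
    index.\<close>
  define \<kappa> where "\<kappa> = density (C \<Otimes>\<^sub>M \<pi>) (\<lambda>q. k (snd q) (fst q))"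
  define \<pi>' where "\<pi>' = distr \<kappa> (borel \<Otimes>\<^sub>M borel) (\<lambda>q. (fst (snd q), y (fst q)))"
  have sets_\<pi>'[measurable_cong]: "sets \<pi>' = sets (borel \<Otimes>\<^sub>M borel)" by (simp add: \<pi>'_def)
  have nn: "(\<integral>\<^sup>+p. h p \<partial>\<pi>') = (\<integral>\<^sup>+p. (\<Sum>t\<in>{1..n}. k p t * h (fst p, y t)) \<partial>\<pi>)"
    if [measurable]: "h \<in> borel_measurable (borel \<Otimes>\<^sub>M borel)" for h :: "'a \<times> 'a \<Rightarrow> ennreal"
  proof -
    have "(\<integral>\<^sup>+p. h p \<partial>\<pi>') = (\<integral>\<^sup>+q. k (snd q) (fst q) * h (fst (snd q), y (fst q)) \<partial>(C \<Otimes>\<^sub>M \<pi>))"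
      unfolding \<pi>'_def \<kappa>_def
      by (subst nn_integral_distr) (auto intro!: nn_integral_density measurable_compose[OF y_meas that])
    also have "\<dots> = (\<integral>\<^sup>+t. (\<integral>\<^sup>+p. k p t * h (fst p, y t) \<partial>\<pi>) \<partial>C)"
      by (subst \<pi>.nn_integral_fst[symmetric]) (auto intro!: borel_measurable_times measurable_compose[OF y_meas that])
    also have "\<dots> = (\<Sum>t\<in>{1..n}. \<integral>\<^sup>+p. k p t * h (fst p, y t) \<partial>\<pi>)"
      by (simp add: C_def nn_integral_count_space_finite)
    finally show ?thesis by (subst nn_integral_sum) auto
  qed
  have snd_eq: "emeasure \<pi> {p\<in>space \<pi>. snd p \<in> A} = ennreal (card {t\<in>{1..n}. x t \<in> A} / n)"
    if A: "A \<in> sets borel" for A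
  proof -
    have "emeasure \<pi> {p\<in>space \<pi>. snd p \<in> A} = emeasure (distr \<pi> borel snd) A"
      using A by (subst emeasure_distr) (auto intro!: arg_cong[where f="emeasure \<pi>"])
    then show ?thesis by (simp only: snd emeasure_distr_uniform_count[OF A])
  qed
  have m0: "m (x t) > 0" if "t \<in> {1..n}" for t
    using that by (auto simp: m_def card_gt_0_iff)
  have AE1: "AE p in \<pi>. (\<Sum>t\<in>{1..n}. k p t) = 1"
  proof -
    have "emeasure \<pi> {p\<in>space \<pi>. snd p \<in> x ` {1..n}} = 1"
    proof (subst snd_eq)
      have "{t\<in>{1..n}. x t \<in> x ` {1..n}} = {1..n}" by auto
      then show "ennreal (card {t\<in>{1..n}. x t \<in> x ` {1..n}} / n) = 1" using \<open>n > 0\<close> by simp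
    qed (auto intro!: borel_closed finite_imp_closed)
    moreover have [measurable]: "x ` {1..n} \<in> sets borel" by (intro borel_closed finite_imp_closed) simp
    ultimately have "AE p in \<pi>. snd p \<in> x ` {1..n}"
      by (subst \<pi>.AE_iff_emeasure_eq_1) simp_all
    then show ?thesis
    proof eventually_elim
      case (elim p)
      then obtain s where s: "s \<in> {1..n}" "snd p = x s" by auto
      have "(\<Sum>t\<in>{1..n}. k p t) = (\<Sum>t\<in>{t\<in>{1..n}. x t = x s}. ennreal (1 / m (x s)))"
        by (rule sum.mono_neutral_cong_right) (auto simp: k_def s)
      also have "\<dots> = ennreal (real (m (x s)) * (1 / m (x s)))"
        by (subst sum_ennreal) (auto simp: m_def)
      finally show ?case using m0[OF s(1)] by simp
    qed
  qed
  have fst': "distr \<pi>' borel fst = P"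
  proof (rule measure_eqI)
    show "sets (distr \<pi>' borel fst) = sets P" by (simp add: fst[symmetric])
    fix A assume "A \<in> sets (distr \<pi>' borel fst)"
    then have A[measurable]: "A \<in> sets borel" by simp
    have "emeasure (distr \<pi>' borel fst) A = (\<integral>\<^sup>+p. indicator A p \<partial>distr \<pi>' borel fst)" by simp
    also have "\<dots> = (\<integral>\<^sup>+p. indicator A (fst p) \<partial>\<pi>')"
      by (rule nn_integral_distr) auto
    also have "\<dots> = (\<integral>\<^sup>+p. (\<Sum>t\<in>{1..n}. k p t) * indicator A (fst p) \<partial>\<pi>)"
      by (subst nn) (auto simp: sum_distrib_right)
    also have "\<dots> = (\<integral>\<^sup>+p. indicator A (fst p) \<partial>\<pi>)"
      using AE1 by (intro nn_integral_cong_AE) auto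
    also have "\<dots> = (\<integral>\<^sup>+p. indicator A p \<partial>distr \<pi> borel fst)"
      by (rule nn_integral_distr[symmetric]) auto
    finally show "emeasure (distr \<pi>' borel fst) A = emeasure P A" by (simp add: fst[symmetric])
  qed
  have snd': "distr \<pi>' borel snd = distr (uniform_count_measure {1..n}) borel y"
  proof (rule measure_eqI)
    show "sets (distr \<pi>' borel snd) = sets (distr (uniform_count_measure {1..n}) borel y)" by simp
    fix A assume "A \<in> sets (distr \<pi>' borel snd)"
    then have A[measurable]: "A \<in> sets borel" by simp
    have kint: "(\<integral>\<^sup>+p. k p t \<partial>\<pi>) = ennreal (1 / n)" if "t \<in> {1..n}" for t
    proof -
      have "(\<integral>\<^sup>+p. k p t \<partial>\<pi>) = (\<integral>\<^sup>+p. ennreal (1 / m (x t)) * indicator {p\<in>space \<pi>. snd p \<in> {x t}} p \<partial>\<pi>)"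
        by (rule nn_integral_cong) (auto simp: k_def indicator_def)
      also have "\<dots> = ennreal (1 / m (x t)) * emeasure \<pi> {p\<in>space \<pi>. snd p \<in> {x t}}"
        by (rule nn_integral_cmult_indicator) measurable
      also have "\<dots> = ennreal (1 / m (x t)) * ennreal (m (x t) / n)"
        by (subst snd_eq) (auto simp: m_def)
      also have "\<dots> = ennreal (1 / n)"
        using m0[OF that] by (subst ennreal_mult[symmetric]) auto
      finally show ?thesis .
    qed
    have "emeasure (distr \<pi>' borel snd) A = (\<integral>\<^sup>+p. indicator A p \<partial>distr \<pi>' borel snd)" by simp
    also have "\<dots> = (\<integral>\<^sup>+p. indicator A (snd p) \<partial>\<pi>')"
      by (rule nn_integral_distr) auto
    also have "\<dots> = (\<Sum>t\<in>{1..n}. (\<integral>\<^sup>+p. k p t \<partial>\<pi>) * indicator A (y t))"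
      by (subst nn) (auto simp: nn_integral_sum nn_integral_multc)
    also have "\<dots> = (\<Sum>t\<in>{1..n}. ennreal (1 / n) * indicator A (y t))"
      by (intro sum.cong) (auto simp: kint)
    also have "\<dots> = (\<Sum>t\<in>{t\<in>{1..n}. y t \<in> A}. ennreal (1 / n))"
      by (rule sum.mono_neutral_cong_right) (auto simp: indicator_def)
    also have "\<dots> = ennreal (card {t\<in>{1..n}. y t \<in> A} / n)"
      by (subst sum_ennreal) auto
    finally show "emeasure (distr \<pi>' borel snd) A = emeasure (distr (uniform_count_measure {1..n}) borel y) A"
      by (simp only: emeasure_distr_uniform_count[OF A])
  qed
  have "prob_space \<pi>'"
  proof (rule prob_space_distrD)
    show "prob_space (distr \<pi>' borel fst)"
      unfolding fst' by (subst fst[symmetric]) (rule \<pi>.prob_space_distr, simp)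
  qed simp
  moreover have "(\<integral>\<^sup>+p. ennreal ((norm (snd p - fst p))\<^sup>2) \<partial>\<pi>')
       \<le> ennreal (1 + r) * (\<integral>\<^sup>+p. ennreal ((norm (snd p - fst p))\<^sup>2) \<partial>\<pi>) + ennreal (r + r\<^sup>2)"
  proof -
    let ?c = "\<lambda>p. ennreal ((norm (snd p - fst p))\<^sup>2)"
    have pt: "k p t * ennreal ((norm (y t - fst p))\<^sup>2) \<le> k p t * (ennreal (1 + r) * ?c p + ennreal (r + r\<^sup>2))"
      if "t \<in> {1..n}" for p t
    proof (cases "snd p = x t")
      case True
      let ?a = "norm (snd p - fst p)"
      have "norm (y t - fst p) \<le> ?a + r"
        using r[OF that] norm_triangle_ineq[of "snd p - fst p" "y t - x t"] by (simp add: True dist_norm norm_minus_commute)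
      then have "(norm (y t - fst p))\<^sup>2 \<le> (?a + r)\<^sup>2" by (intro power_mono) auto
      \<comment> \<open>The cross term \<open>2 a r\<close> is at most \<open>r (a^2 + 1)\<close>,
        so the factor tends to 1 and the additive error to 0 as \<open>r\<close> shrinks.\<close>
      also have "\<dots> \<le> (1 + r) * ?a\<^sup>2 + (r + r\<^sup>2)"
      proof -
        have "2 * ?a \<le> ?a\<^sup>2 + 1" using zero_le_power2[of "?a - 1"] by (simp add: power2_diff)
        from mult_left_mono[OF this \<open>r \<ge> 0\<close>] show ?thesis by (simp add: power2_sum algebra_simps)
      qed
      finally show ?thesis
        using \<open>r \<ge> 0\<close> by (intro mult_left_mono) (auto simp: ennreal_mult[symmetric] ennreal_plus[symmetric] simp del: ennreal_plus intro!: ennreal_leI)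
    qed (simp add: k_def)
    have "(\<integral>\<^sup>+p. ?c p \<partial>\<pi>') = (\<integral>\<^sup>+p. (\<Sum>t\<in>{1..n}. k p t * ennreal ((norm (y t - fst p))\<^sup>2)) \<partial>\<pi>)"
      by (subst nn) auto
    also have "\<dots> \<le> (\<integral>\<^sup>+p. (\<Sum>t\<in>{1..n}. k p t * (ennreal (1 + r) * ?c p + ennreal (r + r\<^sup>2))) \<partial>\<pi>)"
      by (intro nn_integral_mono sum_mono pt)
    also have "\<dots> = (\<integral>\<^sup>+p. ennreal (1 + r) * ?c p + ennreal (r + r\<^sup>2) \<partial>\<pi>)"
      using AE1 by (intro nn_integral_cong_AE) (auto simp: sum_distrib_right[symmetric])
    also have "\<dots> = ennreal (1 + r) * (\<integral>\<^sup>+p. ?c p \<partial>\<pi>) + ennreal (r + r\<^sup>2)"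
      by (simp add: nn_integral_add nn_integral_cmult \<pi>.emeasure_space_1)
    finally show ?thesis .
  qed
  ultimately show ?thesis using that sets_\<pi>' fst' snd' by blast
qed

text \<open>Some coupling already costs strictly less than \<open>a\<close>, and moving the sample
  points by at most a small \<open>r\<close> raises the cost by an amount that vanishes with
  \<open>r\<close>. Only the coordinates \<open>1..n\<close> are constrained, so the neighbourhood
  is open in the product topology.\<close>

lemma open_ot_cost_less:
  fixes P :: "(real^'d) measure"
  assumes "n > 0"
  shows "open {x :: nat \<Rightarrow> real^'d. ot_cost P (distr (uniform_count_measure {1..n}) borel x) < a}"
proof (subst open_subopen, intro ballI)
  let ?e = "\<lambda>x. distr (uniform_count_measure {1..n}) borel x :: (real^'d) measure"
  let ?c = "\<lambda>\<pi>. \<integral>\<^sup>+p. ennreal ((norm (snd p - fst p :: real^'d))\<^sup>2) \<partial>\<pi>"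
  fix x assume "x \<in> {x. ot_cost P (?e x) < a}"
  then obtain \<pi> where \<pi>: "prob_space \<pi>" "sets \<pi> = sets (borel \<Otimes>\<^sub>M borel)"
      "distr \<pi> borel fst = P" "distr \<pi> borel snd = ?e x" "?c \<pi> < a"
    unfolding ot_cost_def INF_less_iff mem_Collect_eq by blast
  obtain c where c: "?c \<pi> = ennreal c" "c \<ge> 0"
    using \<pi>(5) by (cases "?c \<pi>") auto
  have "((\<lambda>r. ennreal ((1 + r) * c + (r + r\<^sup>2))) \<longlongrightarrow> ennreal ((1 + 0) * c + (0 + 0\<^sup>2))) (at_right 0)"
    by (intro tendsto_intros)
  then have "\<forall>\<^sub>F r in at_right 0. ennreal ((1 + r) * c + (r + r\<^sup>2)) < a"
    using \<pi>(5) c by (intro order_tendstoD(2)) auto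
  then have "\<forall>\<^sub>F r in at_right 0. r > 0 \<and> ennreal ((1 + r) * c + (r + r\<^sup>2)) < a"
    by (intro eventually_conj eventually_at_right_less)
  then obtain r :: real where r: "r > 0" "ennreal ((1 + r) * c + (r + r\<^sup>2)) < a"
    using eventually_happens'[OF trivial_limit_at_right_real] by blast
  define T where "T = (\<Inter>t\<in>{1..n}. {y. dist (x t) (y t) < r})"
  have "open T"
    unfolding T_def
    by (intro open_INT ballI open_Collect_less continuous_intros continuous_on_product_coordinates finite_atLeastAtMost)
  moreover have "x \<in> T" using r by (simp add: T_def)
  moreover have "T \<subseteq> {x. ot_cost P (?e x) < a}"
  proof
    fix y assume "y \<in> T"
    then have "dist (x t) (y t) \<le> r" if "t \<in> {1..n}" for t using that by (force simp: T_def)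
    then obtain \<pi>' where \<pi>': "prob_space \<pi>'" "sets \<pi>' = sets (borel \<Otimes>\<^sub>M borel)"
      "distr \<pi>' borel fst = P" "distr \<pi>' borel snd = ?e y"
      "?c \<pi>' \<le> ennreal (1 + r) * ?c \<pi> + ennreal (r + r\<^sup>2)"
      using coupling_move_atoms[OF \<pi>(1-4) \<open>n > 0\<close>, of y r] r by force
    have "ot_cost P (?e y) \<le> ?c \<pi>'"
      unfolding ot_cost_def using \<pi>' by (intro INF_lower) auto
    also have "\<dots> \<le> ennreal ((1 + r) * c + (r + r\<^sup>2))"
      using \<pi>'(5) r c by (simp add: ennreal_mult ennreal_plus del: ennreal_plus flip: ennreal_plus ennreal_mult)
    also have "\<dots> < a" by (rule r)
    finally show "y \<in> {x. ot_cost P (?e x) < a}" by simp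
  qed
  ultimately show "\<exists>T. open T \<and> x \<in> T \<and> T \<subseteq> {x. ot_cost P (?e x) < a}" by blast
qed

text \<open>A union of open sublevel sets is open however many laws compete, so the profile is a
  Borel function of the sample sequence.\<close>

lemma RWP_measurable:
  fixes X :: "real \<Rightarrow> 'w \<Rightarrow> real^'d"
  assumes "n > 0" and X: "\<And>t. t \<ge> 0 \<Longrightarrow> X t \<in> borel_measurable M"
  shows "(\<lambda>\<omega>. RWP n X \<omega> H) \<in> borel_measurable M"
proof -
  define \<P> where "\<P> = {P. prob_space P \<and> sets P = sets borel \<and>
        (\<forall>i. 1 - H$i$i = 0) \<and> (\<forall>i j. integrable P (\<lambda>x. x$i * x$j)) \<and>
        (\<forall>i j. i \<noteq> j \<longrightarrow> (second_moment P ** H)$i$j = 0)}"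
  define \<Phi> where "\<Phi> x = (INF P\<in>\<P>. ot_cost P (distr (uniform_count_measure {1..n}) borel x))"
    for x :: "nat \<Rightarrow> real^'d"
  have "\<Phi> \<in> borel_measurable borel"
  proof (rule borel_measurableI_less)
    fix a
    have "{x. \<Phi> x < a} = (\<Union>P\<in>\<P>. {x. ot_cost P (distr (uniform_count_measure {1..n}) borel x) < a})"
      by (auto simp: \<Phi>_def INF_less_iff)
    then have "open {x. \<Phi> x < a}"
      by (simp only:) (intro open_UN ballI open_ot_cost_less[OF \<open>n > 0\<close>])
    then show "{x \<in> space borel. \<Phi> x < a} \<in> sets borel" by simp
  qed
  moreover have "(\<lambda>\<omega> t. X (real t) \<omega>) \<in> measurable M (borel :: (nat \<Rightarrow> real^'d) measure)"
    by (subst measurable_cong_sets[OF refl sets_PiM_equal_borel[symmetric]])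
       (rule measurable_PiM_single', auto intro: X)
  ultimately have "(\<lambda>\<omega>. \<Phi> (\<lambda>t. X (real t) \<omega>)) \<in> borel_measurable M"
    by (rule measurable_compose_rev)
  then show ?thesis
    by (simp add: RWP_def \<Phi>_def \<P>_def empirical_def)
qed

lemma ext_enn_measurable:
  assumes "continuous_on UNIV f"
  shows "ext_enn f \<in> borel_measurable borel"
proof -
  have [measurable]: "f \<in> borel_measurable borel"
    using assms by (rule borel_measurable_continuous_onI)
  show ?thesis unfolding ext_enn_def[abs_def] by measurable
qed

lemma abs_ext_enn_le:
  assumes "\<And>x. \<bar>f x\<bar> \<le> C"
  shows "\<bar>ext_enn f x\<bar> \<le> C"
proof (cases "x = \<infinity>")
  case True
  have "f y \<le> C" "- C \<le> f y" for y using assms[of y] by auto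
  moreover have "f 0 \<le> (SUP y. f y)"
    using assms by (intro cSUP_upper) (auto intro!: bdd_aboveI2[where M = C] simp: abs_le_iff)
  ultimately have "(SUP y. f y) \<le> C" "- C \<le> (SUP y. f y)"
    by (auto intro: cSUP_least order_trans)
  with True show ?thesis by (simp add: ext_enn_def abs_le_iff)
qed (simp add: ext_enn_def assms)

text \<open>A finite upper bound excludes the value at infinity, which leaves monotonicity of
  \<open>f\<close>.\<close>

lemma ext_enn_le:
  assumes "mono f" "x \<le> ennreal y" "y \<ge> 0"
  shows "ext_enn f x \<le> f y"
  using assms by (cases x) (auto simp: ext_enn_def top_unique dest: monoD)

subsection \<open>Upper bound by linear transport\<close>

lemma transpose_inner_matrix_mult:
  fixes A :: "real^'n^'m" and B :: "real^'k^'n"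
  shows "(A ** B) \<bullet> C = B \<bullet> (transpose A ** C)"
proof -
  have "(A ** B) \<bullet> C = (\<Sum>i\<in>UNIV. \<Sum>j\<in>UNIV. \<Sum>l\<in>UNIV. A$i$l * B$l$j * C$i$j)"
    by (simp add: inner_vec_def matrix_matrix_mult_def sum_distrib_right)
  also have "\<dots> = (\<Sum>l\<in>UNIV. \<Sum>j\<in>UNIV. \<Sum>i\<in>UNIV. A$i$l * B$l$j * C$i$j)"
    by (rule trans[OF sum.cong[OF refl sum.swap] trans[OF sum.swap sum.cong[OF refl sum.swap]]])
  also have "\<dots> = B \<bullet> (transpose A ** C)"
    by (simp add: inner_vec_def matrix_matrix_mult_def transpose_def sum_distrib_left mult_ac)
  finally show ?thesis .
qed

lemma inner_transpose: "transpose A \<bullet> transpose B = A \<bullet> (B :: real^'n^'m)"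
  unfolding inner_vec_def transpose_def by (subst sum.swap) simp

lemma matrix_inner_columns: "A \<bullet> B = (\<Sum>i\<in>UNIV. column i A \<bullet> column i (B :: real^'n^'m))"
  by (simp add: inner_vec_def column_def) (rule sum.swap)

lemma column_matrix_mult: "column i (A ** B) = A *v column i (B :: real^'k^'n)"
  by (simp add: column_def matrix_matrix_mult_def matrix_vector_mult_def)

lemma quadratic_form_gram:
  "x \<bullet> ((B ** transpose B) *v x) = (norm (transpose B *v x))\<^sup>2" for B :: "real^'d^'d"
  by (simp only: matrix_vector_mul_assoc[symmetric] power2_norm_eq_inner transpose_matrix_vector dot_lmul_matrix)

lemma transpose_second_moment: "transpose (second_moment P) = second_moment P"
  by (simp add: second_moment_def transpose_def vec_eq_iff mult.commute)

text \<open>The trace form serves twice: for \<open>Pstar\<close> it exhibits the objective as a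
  quadratic polynomial in \<open>H\<close>, and for the empirical measure it evaluates the cost of
  the displacement by \<open>transpose B *v x\<close>.\<close>

lemma lsq_obj_eq:
  fixes P :: "(real^'d) measure"
  assumes int: "\<And>i j. integrable P (\<lambda>x. x$i * x$j)"
  shows "integrable P (\<lambda>x. x \<bullet> ((H ** transpose H) *v x))"
    and "lsq_obj P H = (second_moment P ** H) \<bullet> H"
proof -
  let ?G = "H ** transpose H"
  have eq: "x \<bullet> (?G *v x) = (\<Sum>i\<in>UNIV. \<Sum>j\<in>UNIV. ?G$i$j * (x$i * x$j))" for x
    by (simp add: inner_vec_def matrix_vector_mult_def sum_distrib_left mult_ac)
  show "integrable P (\<lambda>x. x \<bullet> (?G *v x))"
    unfolding eq by (intro Bochner_Integration.integrable_sum integrable_mult_right int)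
  have "lsq_obj P H = (\<Sum>i\<in>UNIV. \<Sum>j\<in>UNIV. ?G$i$j * second_moment P $i$j)"
    unfolding lsq_obj_def eq by (simp add: int second_moment_def)
  also have "\<dots> = (H ** transpose H) \<bullet> second_moment P" by (simp add: inner_vec_def)
  also have "\<dots> = transpose H \<bullet> (transpose H ** second_moment P)"
    by (rule transpose_inner_matrix_mult)
  also have "transpose H ** second_moment P = transpose (second_moment P ** H)"
    by (simp only: matrix_transpose_mul transpose_second_moment)
  also have "transpose H \<bullet> transpose (second_moment P ** H) = (second_moment P ** H) \<bullet> H"
    by (simp only: inner_transpose inner_commute)
  finally show "lsq_obj P H = (second_moment P ** H) \<bullet> H" .
qed

text \<open>Changing a single off-diagonal entry respects the constraint. Along this line the
  objective is a parabola whose slope at the minimiser is twice the entry in question.\<close>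

lemma lsq_obj_minimizer_off_diagonal:
  fixes P :: "(real^'d) measure"
  assumes int: "\<And>i j. integrable P (\<lambda>x. x$i * x$j)"
    and diag: "\<And>i. H$i$i = 1"
    and min: "\<And>H'. (\<forall>i. H'$i$i = 1) \<Longrightarrow> lsq_obj P H \<le> lsq_obj P H'"
    and ij: "i \<noteq> j"
  shows "(second_moment P ** H)$i$j = 0"
proof (rule ccontr)
  let ?S = "second_moment P"
  define E :: "real^'d^'d" where "E = axis i (axis j 1)"
  define g q where "g = (?S ** H) $ i $ j" and "q = (?S ** E) \<bullet> E"
  assume "(?S ** H)$i$j \<noteq> 0"
  then have "g \<noteq> 0" by (simp add: g_def)
  have gE: "(?S ** H) \<bullet> E = g" "(?S ** E) \<bullet> H = g"
  proof -
    show 1: "(?S ** H) \<bullet> E = g" by (simp add: E_def inner_axis g_def)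
    then show "(?S ** E) \<bullet> H = g"
      by (simp only: transpose_inner_matrix_mult[of _ E] transpose_second_moment inner_commute[of E])
  qed
  have "0 \<le> s * (2 * g + s * q)" for s
  proof -
    have "(H + s *\<^sub>R E) $ a $ a = 1" for a
      using ij diag by (auto simp: E_def axis_def)
    from min[of "H + s *\<^sub>R E"] this have "(?S ** H) \<bullet> H \<le> (?S ** (H + s *\<^sub>R E)) \<bullet> (H + s *\<^sub>R E)"
      by (simp add: lsq_obj_eq(2)[OF int])
    also have "\<dots> = (?S ** H) \<bullet> H + s * (2 * g + s * q)"
      by (simp add: matrix_add_ldistrib matrix_mult_scaleR_right inner_add_left inner_add_right gE q_def algebra_simps)
    finally show ?thesis by simp
  qed
  \<comment> \<open>This step has the sign opposite to \<open>g\<close> and is short enough for the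
    linear term to win whatever \<open>q\<close> is; the 1 in the denominator covers
    \<open>q = 0\<close>.\<close>
  from this[of "- g / (\<bar>q\<bar> + 1)"]
  have "0 \<le> - (g\<^sup>2 / (\<bar>q\<bar> + 1)) * (2 - q / (\<bar>q\<bar> + 1))"
    by (simp add: power2_eq_square field_simps)
  moreover have "q / (\<bar>q\<bar> + 1) < 2" by (simp add: field_simps)
  then have "(g\<^sup>2 / (\<bar>q\<bar> + 1)) * (2 - q / (\<bar>q\<bar> + 1)) > 0"
    using \<open>g \<noteq> 0\<close> by (intro mult_pos_pos divide_pos_pos) auto
  ultimately show False by simp
qed

text \<open>One feasible law and one coupling bound both infima. Nonnegativity is recorded as well
  because \<open>ennreal\<close> truncates negative reals, and the later comparison under
  \<open>f\<close> is between real numbers.\<close>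

lemma RWP_le_congruence:
  fixes X :: "real \<Rightarrow> 'w \<Rightarrow> real^'d"
  assumes "n > 0"
    and congr: "transpose (mat 1 + B) ** second_moment (empirical n X \<omega>) ** (mat 1 + B) = \<Sigma>"
    and H: "\<And>i. H$i$i = 1" "\<And>i j. i \<noteq> j \<Longrightarrow> (\<Sigma> ** H)$i$j = 0"
  shows "RWP n X \<omega> H \<le> ennreal ((second_moment (empirical n X \<omega>) ** B) \<bullet> B)"
    and "0 \<le> (second_moment (empirical n X \<omega>) ** B) \<bullet> B"
proof -
  define e where "e = empirical n X \<omega>"
  define C where "C = mat 1 + B"
  define T where "T x = transpose C *v x" for x
  have em: "(\<lambda>t. X (real t) \<omega>) \<in> measurable (uniform_count_measure {1..n}) borel"
    by (subst measurable_cong_sets[OF sets_uniform_count_measure_count_space refl]) simp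
  have sets_e[measurable_cong]: "sets e = sets borel" by (simp add: e_def empirical_def)
  interpret e: prob_space e
    unfolding e_def empirical_def using \<open>n > 0\<close>
    by (intro prob_space.prob_space_distr[OF prob_space_uniform_count_measure em]) auto
  have int: "integrable e (\<lambda>x. x$i * x$j)" for i j
    unfolding e_def empirical_def
    by (subst integrable_distr_eq[OF em]) (auto simp: uniform_count_measure_def integrable_point_measure_finite)
  have T_meas[measurable]: "T \<in> borel_measurable borel"
    unfolding T_def by (intro borel_measurable_continuous_onI matrix_vector_mult_linear_continuous_on)
  define P where "P = distr e borel T"
  \<comment> \<open>The graph coupling of the linear map; the moved point comes first, since
    \<open>ot_cost\<close> takes the feasible law as its first marginal.\<close>
  define \<pi> where "\<pi> = distr e (borel \<Otimes>\<^sub>M borel) (\<lambda>x. (T x, x))"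
  have Tij: "T x $ i * T x $ j = (\<Sum>a\<in>UNIV. \<Sum>b\<in>UNIV. C$a$i * C$b$j * (x$a * x$b))" for x i j
    by (simp add: T_def matrix_vector_mult_def transpose_def sum_product mult_ac)
  have Pint: "integrable P (\<lambda>x. x$i * x$j)" for i j
    unfolding P_def by (subst integrable_distr_eq) (auto simp: Tij intro!: Bochner_Integration.integrable_sum integrable_mult_right int)
  have "second_moment P = transpose C ** second_moment e ** C"
  proof -
    have "second_moment P $ i $ j = (\<Sum>a\<in>UNIV. \<Sum>b\<in>UNIV. C$a$i * C$b$j * second_moment e $ a $ b)" for i j
    proof -
      have "second_moment P $ i $ j = (\<integral>x. T x $ i * T x $ j \<partial>e)"
        unfolding second_moment_def P_def by (simp add: integral_distr)
      then show ?thesis by (simp add: Tij int second_moment_def)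
    qed
    moreover have "(transpose C ** second_moment e ** C) $ i $ j = (\<Sum>a\<in>UNIV. \<Sum>b\<in>UNIV. C$a$i * C$b$j * second_moment e $ a $ b)" for i j
      by (subst sum.swap) (simp add: matrix_matrix_mult_def transpose_def sum_distrib_left mult_ac)
    ultimately show ?thesis by (simp add: vec_eq_iff)
  qed
  then have "second_moment P = \<Sigma>" using congr by (simp add: C_def e_def)
  moreover have "prob_space P" unfolding P_def by (rule e.prob_space_distr) simp
  ultimately have "RWP n X \<omega> H \<le> ot_cost P e"
    unfolding RWP_def e_def[symmetric] using H Pint by (intro INF_lower) (auto simp: P_def)
  also have "\<dots> \<le> (\<integral>\<^sup>+p. ennreal ((norm (snd p - fst p))\<^sup>2) \<partial>\<pi>)"
  proof -
    have "prob_space \<pi>" unfolding \<pi>_def by (rule e.prob_space_distr) simp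
    moreover have "distr \<pi> borel fst = P"
      unfolding \<pi>_def P_def by (subst distr_distr) (auto simp: comp_def)
    moreover have "distr \<pi> borel snd = e"
      unfolding \<pi>_def by (subst distr_distr) (simp_all add: comp_def distr_id2 sets_e)
    moreover have "sets \<pi> = sets (borel \<Otimes>\<^sub>M borel)" by (simp add: \<pi>_def)
    ultimately show ?thesis
      unfolding ot_cost_def by (intro INF_lower) blast
  qed
  also have "\<dots> = (\<integral>\<^sup>+x. ennreal ((norm (x - T x))\<^sup>2) \<partial>e)"
    unfolding \<pi>_def by (subst nn_integral_distr) auto
  also have "\<dots> = (\<integral>\<^sup>+x. ennreal (x \<bullet> ((B ** transpose B) *v x)) \<partial>e)"
    by (simp add: T_def C_def transpose_add transpose_mat matrix_vector_mult_add_rdistrib quadratic_form_gram)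
  also have "\<dots> = ennreal (lsq_obj e B)"
    unfolding lsq_obj_def
    by (rule nn_integral_eq_integral) (simp_all add: lsq_obj_eq(1)[OF int], simp add: quadratic_form_gram)
  also have lsq: "lsq_obj e B = (second_moment e ** B) \<bullet> B" by (rule lsq_obj_eq(2)[OF int])
  finally show "RWP n X \<omega> H \<le> ennreal ((second_moment (empirical n X \<omega>) ** B) \<bullet> B)"
    by (simp add: e_def)
  have "0 \<le> lsq_obj e B" by (simp add: lsq_obj_def quadratic_form_gram)
  then show "0 \<le> (second_moment (empirical n X \<omega>) ** B) \<bullet> B" by (simp only: lsq e_def[symmetric])
qed

section \<open>The empirical second moment and the passage to the limit\<close>

lemma second_moment_empirical:
  fixes X :: "real \<Rightarrow> 'w \<Rightarrow> real^'d"
  shows "second_moment (empirical n X \<omega>) =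
    (1 / real n) *\<^sub>R (\<Sum>t\<in>{1..n}. \<chi> i j. X (real t) \<omega> $ i * X (real t) \<omega> $ j)"
proof -
  have em: "(\<lambda>t. X (real t) \<omega>) \<in> measurable (uniform_count_measure {1..n}) borel"
    by (subst measurable_cong_sets[OF sets_uniform_count_measure_count_space refl]) simp
  have "(\<integral>x. x$i * x$j \<partial>empirical n X \<omega>) = (\<Sum>t\<in>{1..n}. X (real t) \<omega> $ i * X (real t) \<omega> $ j) / n" for i j
    unfolding empirical_def by (subst integral_distr[OF em]) (simp_all add: integral_uniform_count_measure)
  then show ?thesis by (simp add: second_moment_def vec_eq_iff)
qed

text \<open>\<open>second_moment\<close> integrates entry by entry, whereas the central limit
  property centres by a matrix-valued integral; expansion in unit matrices reconciles them.\<close>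

lemma second_moment_eq_integral:
  fixes P :: "(real^'d) measure"
  assumes int: "\<And>i j. integrable P (\<lambda>x. x$i * x$j)"
  shows "second_moment P = (\<integral>x. (\<chi> i j. x$i * x$j) \<partial>P)"
proof -
  have sum_if: "(\<Sum>b\<in>UNIV. if Q then h b else 0) = (if Q then \<Sum>b\<in>UNIV. h b else 0)"
    for Q and h :: "'d \<Rightarrow> real"
    by simp
  have eq: "(\<chi> i j. x$i * x$j) = (\<Sum>i\<in>UNIV. \<Sum>j\<in>UNIV. (x$i * x$j) *\<^sub>R axis i (axis j 1))" for x :: "real^'d"
    by (simp add: vec_eq_iff axis_def if_distrib[of "\<lambda>v. v $ _"] if_distrib[of "(*) _"] sum_if cong: if_cong)
  have "(\<integral>x. (\<chi> i j. x$i * x$j) \<partial>P) = (\<Sum>i\<in>UNIV. \<Sum>j\<in>UNIV. (\<integral>x. x$i * x$j \<partial>P) *\<^sub>R axis i (axis j 1))"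
    unfolding eq by (simp add: int)
  also have "\<dots> = second_moment P"
    by (simp add: second_moment_def vec_eq_iff axis_def if_distrib[of "\<lambda>v. v $ _"] if_distrib[of "(*) _"] sum_if cong: if_cong)
  finally show ?thesis ..
qed

lemma growth_bounded_outer_product: "growth_bounded (\<lambda>x :: real^'d. \<chi> i j. x$i * x$j)"
  unfolding growth_bounded_def
proof (intro exI conjI allI)
  fix x :: "real^'d"
  have "(\<Sum>i\<in>UNIV. \<Sum>j\<in>UNIV. \<bar>x$i * x$j\<bar>) \<le> (\<Sum>i\<in>(UNIV :: 'd set). \<Sum>j\<in>(UNIV :: 'd set). (norm x)\<^sup>2)"
    unfolding abs_mult power2_eq_square by (intro sum_mono mult_mono component_le_norm_cart) auto
  also have "\<dots> = (real CARD('d))\<^sup>2 * (norm x)\<^sup>2" by (simp add: power2_eq_square)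
  also have "\<dots> \<le> (real CARD('d))\<^sup>2 * (1 + (norm x)\<^sup>2)" by (intro mult_left_mono) auto
  finally show "(\<Sum>i\<in>UNIV. \<Sum>j\<in>UNIV. \<bar>(\<chi> i j. x$i * x$j) $ i $ j\<bar>) \<le> (real CARD('d))\<^sup>2 * (1 + (norm x)\<^sup>2)"
    by simp
qed simp

text \<open>For each fixed \<open>k\<close>, the integrand is eventually dominated by a bounded
  continuous function \<open>F k\<close> of \<open>Z n\<close>, to which weak convergence applies.
  Letting \<open>k\<close> grow afterwards removes the error by dominated convergence.\<close>

lemma transport_bound_limit:
  fixes M :: "'w measure" and X :: "real \<Rightarrow> 'w \<Rightarrow> real^'d" and Z :: "nat \<Rightarrow> 'w \<Rightarrow> real^'d^'d"
    and \<Sigma> \<Sigma>' H :: "real^'d^'d"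
  defines "q z \<equiv> 1/4 * (z \<bullet> (\<Sigma>' ** z))"
  assumes "prob_space M" and X: "\<And>t. t \<ge> 0 \<Longrightarrow> X t \<in> borel_measurable M"
    and \<Sigma>: "transpose \<Sigma> = \<Sigma>" "\<Sigma> ** \<Sigma>' = mat 1"
    and H: "\<And>i. H$i$i = 1" "\<And>i j. i \<noteq> j \<Longrightarrow> (\<Sigma> ** H)$i$j = 0"
    and Z_def: "\<And>n \<omega>. Z n \<omega> = sqrt (real n) *\<^sub>R (second_moment (empirical n X \<omega>) - \<Sigma>)"
    and Z_meas[measurable]: "\<And>n. Z n \<in> borel_measurable M"
    and "prob_space \<mu>" and sets_\<mu>[measurable_cong]: "sets \<mu> = sets borel"
    and conv: "weak_conv_gen (\<lambda>n. distr M borel (Z n)) \<mu>"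
    and f: "continuous_on UNIV f" "mono f" and C: "\<And>x. \<bar>f x\<bar> \<le> C"
  shows "limsup (\<lambda>n. ereal (\<integral>\<omega>. ext_enn f (of_nat n * RWP n X \<omega> H) \<partial>M)) \<le> ereal (\<integral>z. f (q z) \<partial>\<mu>)"
proof -
  interpret M: prob_space M by fact
  interpret \<mu>: prob_space \<mu> by fact
  have f_cont: "continuous_on S g \<Longrightarrow> continuous_on S (\<lambda>x. f (g x))" for S and g :: "real^'d^'d \<Rightarrow> real"
    using f(1) continuous_on_compose2 by blast
  \<comment> \<open>\<open>1 / Suc k\<close> is the relative error \<open>\<eta>\<close> of the
    transport cost. The second summand is 0 for \<open>norm z \<le> k\<close> and
    \<open>2 * C\<close> for \<open>norm z \<ge> k + 1\<close>, where it lifts \<open>F k z\<close>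
    to at least \<open>C\<close>, above every value of \<open>ext_enn f\<close>. The ramp in between
    keeps \<open>F k\<close> continuous.\<close>
  define F where "F k z = f (q z + 1 / real (Suc k) * (norm z)\<^sup>2) + 2 * C * min 1 (max 0 (norm z - real k))"
    for k :: nat and z :: "real^'d^'d"
  have "C \<ge> 0" using C[of 0] by simp
  have F_cont: "continuous_on UNIV (F k)" for k
    unfolding F_def q_def by (intro continuous_intros f_cont)
  have F_meas[measurable]: "F k \<in> borel_measurable borel" for k
    using F_cont by (rule borel_measurable_continuous_onI)
  have F_bd: "\<bar>F k z\<bar> \<le> 3 * C" for k z
  proof -
    have "2 * C * min 1 (max 0 (norm z - real k)) \<le> 2 * C * 1"
      using \<open>C \<ge> 0\<close> by (intro mult_left_mono) auto
    moreover have "0 \<le> 2 * C * min 1 (max 0 (norm z - real k))"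
      using \<open>C \<ge> 0\<close> by simp
    ultimately show ?thesis using C[of "q z + 1 / real (Suc k) * (norm z)\<^sup>2"] unfolding F_def by linarith
  qed
  have lim_F: "(\<lambda>n. \<integral>\<omega>. F k (Z n \<omega>) \<partial>M) \<longlonglongrightarrow> (\<integral>z. F k z \<partial>\<mu>)" for k
  proof -
    have "bounded (range (F k))" using F_bd by (auto simp: bounded_iff)
    then have "(\<lambda>n. \<integral>z. F k z \<partial>distr M borel (Z n)) \<longlonglongrightarrow> (\<integral>z. F k z \<partial>\<mu>)"
      using conv F_cont by (auto simp: weak_conv_gen_def)
    then show ?thesis by (simp add: integral_distr)
  qed
  have bound: "limsup (\<lambda>n. ereal (\<integral>\<omega>. ext_enn f (of_nat n * RWP n X \<omega> H) \<partial>M)) \<le> ereal (\<integral>z. F k z \<partial>\<mu>)" for k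
  proof -
    let ?\<eta> = "1 / real (Suc k)"
    have "?\<eta> > 0" by simp
    from congruence_correction[OF \<Sigma> this] obtain \<delta> where \<delta>: "\<delta> > 0"
      "\<forall>S. transpose S = S \<longrightarrow> norm (S - \<Sigma>) \<le> \<delta> \<longrightarrow>
         (\<exists>B. transpose (mat 1 + B) ** S ** (mat 1 + B) = \<Sigma> \<and>
           (S ** B) \<bullet> B \<le> 1/4 * ((S - \<Sigma>) \<bullet> (\<Sigma>' ** (S - \<Sigma>))) + ?\<eta> * (norm (S - \<Sigma>))\<^sup>2)"
      by (elim exE conjE)
    \<comment> \<open>Once \<open>sqrt n * \<delta>\<close> exceeds \<open>k + 1\<close>, every
      sample with \<open>norm (Z n \<omega>) \<le> k + 1\<close> lies in the region where the
      correction \<open>B\<close> exists.\<close>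
    have "filterlim (\<lambda>n. sqrt (real n) * \<delta>) at_top sequentially"
      using \<delta>(1) by (intro filterlim_at_top_mult_tendsto_pos[OF tendsto_const] filterlim_compose[OF sqrt_at_top filterlim_real_sequentially])
    then have "\<forall>\<^sub>F n in sequentially. sqrt (real n) * \<delta> \<ge> real k + 1"
      by (simp add: filterlim_at_top)
    then have "\<forall>\<^sub>F n in sequentially. n > 0 \<and> sqrt (real n) * \<delta> \<ge> real k + 1"
      by (intro eventually_conj eventually_gt_at_top)
    then have "\<forall>\<^sub>F n in sequentially. ereal (\<integral>\<omega>. ext_enn f (of_nat n * RWP n X \<omega> H) \<partial>M) \<le> ereal (\<integral>\<omega>. F k (Z n \<omega>) \<partial>M)"
    proof eventually_elim
      case (elim n)
      then have n: "n > 0" "sqrt (real n) > 0" by auto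
      have pt: "ext_enn f (of_nat n * RWP n X \<omega> H) \<le> F k (Z n \<omega>)" for \<omega>
      proof (cases "norm (Z n \<omega>) \<le> real k + 1")
        case True
        define S where "S = second_moment (empirical n X \<omega>)"
        have Z_S: "Z n \<omega> = sqrt (real n) *\<^sub>R (S - \<Sigma>)" by (simp only: Z_def S_def)
        have "sqrt (real n) * norm (S - \<Sigma>) \<le> real k + 1"
          using True by (simp add: Z_S)
        with elim have "sqrt (real n) * norm (S - \<Sigma>) \<le> sqrt (real n) * \<delta>" by linarith
        then have "norm (S - \<Sigma>) \<le> \<delta>" using n by simp
        then obtain B where B: "transpose (mat 1 + B) ** S ** (mat 1 + B) = \<Sigma>"
            "(S ** B) \<bullet> B \<le> 1/4 * ((S - \<Sigma>) \<bullet> (\<Sigma>' ** (S - \<Sigma>))) + ?\<eta> * (norm (S - \<Sigma>))\<^sup>2"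
          using \<delta>(2)[rule_format, of S] transpose_second_moment[of "empirical n X \<omega>", folded S_def] by blast
        have "n * ((S ** B) \<bullet> B) \<le> n * (1/4 * ((S - \<Sigma>) \<bullet> (\<Sigma>' ** (S - \<Sigma>))) + ?\<eta> * (norm (S - \<Sigma>))\<^sup>2)"
          using B(2) by (intro mult_left_mono) auto
        \<comment> \<open>Both terms are homogeneous of degree two, so the factor \<open>n\<close>
          becomes one \<open>sqrt n\<close> on each copy of \<open>S - \<Sigma>\<close>.\<close>
        also have "\<dots> = q (Z n \<omega>) + ?\<eta> * (norm (Z n \<omega>))\<^sup>2"
          unfolding q_def Z_S
          by (simp add: matrix_mult_scaleR_right power_mult_distrib distrib_left mult.left_commute del: of_nat_Suc)
        finally have le: "n * ((S ** B) \<bullet> B) \<le> q (Z n \<omega>) + ?\<eta> * (norm (Z n \<omega>))\<^sup>2" .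
        have B': "transpose (mat 1 + B) ** second_moment (empirical n X \<omega>) ** (mat 1 + B) = \<Sigma>"
          using B(1) by (simp add: S_def)
        have RWP_le: "RWP n X \<omega> H \<le> ennreal ((S ** B) \<bullet> B)" and cost0: "0 \<le> (S ** B) \<bullet> B"
          unfolding S_def by (rule RWP_le_congruence[OF n(1) B' H]; assumption)+
        have "of_nat n * RWP n X \<omega> H \<le> ennreal n * ennreal ((S ** B) \<bullet> B)"
          using RWP_le by (simp add: ennreal_of_nat_eq_real_of_nat mult_left_mono)
        also have "\<dots> = ennreal (n * ((S ** B) \<bullet> B))"
          by (simp add: ennreal_mult')
        finally have "ext_enn f (of_nat n * RWP n X \<omega> H) \<le> f (n * ((S ** B) \<bullet> B))"
          using cost0 by (intro ext_enn_le f) auto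
        also have "\<dots> \<le> f (q (Z n \<omega>) + ?\<eta> * (norm (Z n \<omega>))\<^sup>2)"
          using le f(2) by (rule monoD[rotated])
        also have "\<dots> \<le> F k (Z n \<omega>)"
          unfolding F_def using \<open>C \<ge> 0\<close> by simp
        finally show ?thesis .
      next
        case False
        then have "F k (Z n \<omega>) \<ge> C"
          unfolding F_def using C[of "q (Z n \<omega>) + ?\<eta> * (norm (Z n \<omega>))\<^sup>2"] by simp
        then show ?thesis using abs_ext_enn_le[of f C "of_nat n * RWP n X \<omega> H", OF C] by linarith
      qed
      have meas: "(\<lambda>\<omega>. ext_enn f (of_nat n * RWP n X \<omega> H)) \<in> borel_measurable M"
        by (rule measurable_compose[OF _ ext_enn_measurable[OF f(1)]])
           (intro borel_measurable_times_ennreal borel_measurable_const RWP_measurable n X)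
      have "(\<integral>\<omega>. ext_enn f (of_nat n * RWP n X \<omega> H) \<partial>M) \<le> (\<integral>\<omega>. F k (Z n \<omega>) \<partial>M)"
      proof (rule integral_mono)
        show "integrable M (\<lambda>\<omega>. ext_enn f (of_nat n * RWP n X \<omega> H))"
          using meas abs_ext_enn_le[of f C, OF C] by (intro M.integrable_const_bound[where B = C]) auto
        show "integrable M (\<lambda>\<omega>. F k (Z n \<omega>))"
          using F_bd by (intro M.integrable_const_bound[where B = "3 * C"]) auto
      qed (rule pt)
      then show ?case by simp
    qed
    then have "limsup (\<lambda>n. ereal (\<integral>\<omega>. ext_enn f (of_nat n * RWP n X \<omega> H) \<partial>M)) \<le> limsup (\<lambda>n. ereal (\<integral>\<omega>. F k (Z n \<omega>) \<partial>M))"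
      by (rule Limsup_mono)
    also have "\<dots> = ereal (\<integral>z. F k z \<partial>\<mu>)"
      using lim_F by (intro lim_imp_Limsup) auto
    finally show ?thesis .
  qed
  have "(\<lambda>k. \<integral>z. F k z \<partial>\<mu>) \<longlonglongrightarrow> (\<integral>z. f (q z) \<partial>\<mu>)"
  proof (rule integral_dominated_convergence[where w = "\<lambda>_. 3 * C"])
    have "(\<lambda>z. f (q z)) \<in> borel_measurable borel"
      unfolding q_def by (intro borel_measurable_continuous_onI f_cont continuous_intros)
    then show "(\<lambda>z. f (q z)) \<in> borel_measurable \<mu>" by simp
    have "(\<lambda>k. F k z) \<longlonglongrightarrow> f (q z)" for z
    proof -
      have "(\<lambda>k. q z + 1 / real (Suc k) * (norm z)\<^sup>2) \<longlonglongrightarrow> q z + 0 * (norm z)\<^sup>2"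
        by (intro tendsto_intros LIMSEQ_Suc[OF lim_1_over_n])
      moreover have "isCont f x" for x
        using f(1) by (simp add: continuous_on_eq_continuous_at)
      ultimately have "(\<lambda>k. f (q z + 1 / real (Suc k) * (norm z)\<^sup>2)) \<longlonglongrightarrow> f (q z + 0 * (norm z)\<^sup>2)"
        by (rule isCont_tendsto_compose[rotated])
      then have "(\<lambda>k. f (q z + 1 / real (Suc k) * (norm z)\<^sup>2)) \<longlonglongrightarrow> f (q z)" by simp
      moreover have "\<forall>\<^sub>F k in sequentially. f (q z + 1 / real (Suc k) * (norm z)\<^sup>2) = F k z"
        using eventually_ge_at_top[of "nat \<lceil>norm z\<rceil>"]
      proof eventually_elim
        case (elim k)
        then have "norm z \<le> real k" by linarith
        then show ?case by (simp add: F_def)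
      qed
      ultimately show ?thesis by (rule Lim_transform_eventually)
    qed
    then show "AE z in \<mu>. (\<lambda>k. F k z) \<longlonglongrightarrow> f (q z)" by simp
    show "AE z in \<mu>. norm (F k z) \<le> 3 * C" for k using F_bd by simp
  qed simp_all
  then have "(\<lambda>k. ereal (\<integral>z. F k z \<partial>\<mu>)) \<longlonglongrightarrow> ereal (\<integral>z. f (q z) \<partial>\<mu>)" by simp
  then show ?thesis by (rule LIMSEQ_le_const) (use bound in blast)
qed

theorem theorem2:
  fixes M :: "'w measure" and X :: "real \<Rightarrow> 'w \<Rightarrow> real^'d" and Pstar :: "(real^'d) measure"
    and Hstar :: "real^'d^'d"
  assumes "prob_space M"
    and "\<And>t. t \<ge> 0 \<Longrightarrow> X t \<in> borel_measurable M"
    and "stationary_proc M X"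
    and "ergodic_proc M X"
    and "\<And>t. t \<ge> 0 \<Longrightarrow> distr M borel (X t) = Pstar"
    and "integrable Pstar (\<lambda>x. (norm x) ^ 4)"
    and "\<exists>f. f \<in> borel_measurable borel \<and> Pstar = density lborel f"
    and "clt_property M X Pstar"
    and "invertible (second_moment Pstar)"
    and "{H. (\<forall>i. H$i$i = 1) \<and> (\<forall>H'. (\<forall>i. H'$i$i = 1) \<longrightarrow> lsq_obj Pstar H \<le> lsq_obj Pstar H')}
           = {Hstar}"
  shows "\<forall>f::real \<Rightarrow> real. continuous_on UNIV f \<and> bounded (range f) \<and> mono f \<longrightarrow>
     (\<forall>N (Z :: 'v \<Rightarrow> real^'d^'d). prob_space N \<and> Z \<in> borel_measurable N \<and>
        gaussian_matrix_law (distr N borel Z) (clt_cov M X (\<lambda>x. \<chi> i j. x$i * x$j)) \<longrightarrow>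
        limsup (\<lambda>n. ereal (\<integral>\<omega>. ext_enn f (of_nat n * RWP n X \<omega> Hstar) \<partial>M))
          \<le> ereal (\<integral>\<omega>. f (\<Sum>i\<in>UNIV. 1/4 * (column i (Z \<omega> ) \<bullet>
                 (matrix_inv (second_moment Pstar) *v column i (Z \<omega>)))) \<partial>N))"
proof (intro allI impI, elim conjE)
  fix f :: "real \<Rightarrow> real" and N :: "'v measure" and Z :: "'v \<Rightarrow> real^'d^'d"
  assume f: "continuous_on UNIV f" "bounded (range f)" "mono f"
    and "prob_space N" and Z[measurable]: "Z \<in> borel_measurable N"
    and Zlaw: "gaussian_matrix_law (distr N borel Z) (clt_cov M X (\<lambda>x. \<chi> i j. x$i * x$j))"
  define \<Sigma> where "\<Sigma> = second_moment Pstar"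
  define \<Sigma>' where "\<Sigma>' = matrix_inv \<Sigma>"
  define g where "g x = (\<chi> i j. x$i * x$j)" for x :: "real^'d"
  have [measurable_cong]: "sets Pstar = sets borel" using assms(5)[of 0] by auto
  interpret P: prob_space Pstar
    using prob_space.prob_space_distr[OF assms(1) assms(2)[of 0]] assms(5)[of 0] by simp
  have int: "integrable Pstar (\<lambda>x. x$i * x$j)" for i j
  proof (rule Bochner_Integration.integrable_bound)
    show "integrable Pstar (\<lambda>x. 1 + (norm x) ^ 4)" using assms(6) by simp
    have "\<bar>x$i * x$j\<bar> \<le> 1 + (norm x) ^ 4" for x :: "real^'d"
    proof -
      have "\<bar>x$i * x$j\<bar> \<le> norm x * norm x"
        unfolding abs_mult by (intro mult_mono component_le_norm_cart) auto
      \<comment> \<open>With \<open>t = norm x\<close>, nonnegativity of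
        \<open>(t^2 - 1/2)^2\<close> gives \<open>t^2 \<le> t^4 + 1/4\<close>.\<close>
      also have "\<dots> \<le> 1 + (norm x) ^ 4"
        using zero_le_power2[of "(norm x)\<^sup>2 - 1/2"]
        by (simp add: power2_eq_square power4_eq_xxxx algebra_simps)
      finally show ?thesis .
    qed
    then show "AE x in Pstar. norm (x$i * x$j) \<le> norm (1 + (norm x) ^ 4)" by simp
  qed simp
  have H1: "Hstar$i$i = 1" and Hmin: "(\<forall>i. H'$i$i = 1) \<Longrightarrow> lsq_obj Pstar Hstar \<le> lsq_obj Pstar H'" for i H'
    using assms(10) by blast+
  have H0: "(\<Sigma> ** Hstar)$i$j = 0" if "i \<noteq> j" for i j
    unfolding \<Sigma>_def using lsq_obj_minimizer_off_diagonal[OF int H1 Hmin that] .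
  have g_meas[measurable]: "g \<in> borel_measurable borel"
    unfolding g_def by (intro borel_measurable_continuous_onI continuous_intros)
  obtain \<mu> where \<mu>: "gaussian_matrix_law \<mu> (clt_cov M X g)"
      "weak_conv_gen (\<lambda>n. distr M borel (\<lambda>\<omega>. sqrt (real n) *\<^sub>R
             ((1 / real n) *\<^sub>R (\<Sum>t\<in>{1..n}. g (X (real t) \<omega>)) - (\<integral>x. g x \<partial>Pstar)))) \<mu>"
    using assms(8) g_meas growth_bounded_outer_product unfolding clt_property_def g_def by blast
  have \<mu>_eq: "\<mu> = distr N borel Z"
    using gaussian_matrix_law_unique[OF \<mu>(1)[unfolded g_def]] Zlaw .
  have Zn: "sqrt (real n) *\<^sub>R ((1 / real n) *\<^sub>R (\<Sum>t\<in>{1..n}. g (X (real t) \<omega>)) - (\<integral>x. g x \<partial>Pstar))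
      = sqrt (real n) *\<^sub>R (second_moment (empirical n X \<omega>) - \<Sigma>)" for n \<omega>
    by (simp add: \<Sigma>_def g_def second_moment_empirical second_moment_eq_integral[OF int])
  have X_meas[measurable]: "(\<lambda>\<omega>. X (real t) \<omega>) \<in> borel_measurable M" for t
    using assms(2) by simp
  have Zn_meas: "(\<lambda>\<omega>. sqrt (real n) *\<^sub>R (second_moment (empirical n X \<omega>) - \<Sigma>)) \<in> borel_measurable M" for n
    unfolding Zn[symmetric] by measurable
  obtain C where C: "\<bar>f x\<bar> \<le> C" for x
    using f(2) by (auto simp: bounded_iff)
  have \<mu>_prob: "prob_space \<mu>" "sets \<mu> = sets borel"
    using \<mu>(1) by (auto simp: gaussian_matrix_law_def)
  have inv: "\<Sigma> ** \<Sigma>' = mat 1"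
    using someI_ex[OF assms(9)[unfolded invertible_def]] by (simp add: \<Sigma>'_def \<Sigma>_def matrix_inv_def)
  have "limsup (\<lambda>n. ereal (\<integral>\<omega>. ext_enn f (of_nat n * RWP n X \<omega> Hstar) \<partial>M))
      \<le> ereal (\<integral>z. f (1/4 * (z \<bullet> (\<Sigma>' ** z))) \<partial>\<mu>)"
    by (rule transport_bound_limit[OF assms(1,2) _ inv H1 H0 refl Zn_meas \<mu>_prob \<mu>(2)[unfolded Zn] f(1,3) C])
       (simp_all add: \<Sigma>_def transpose_second_moment)
  also have "(\<integral>z. f (1/4 * (z \<bullet> (\<Sigma>' ** z))) \<partial>\<mu>) = (\<integral>\<omega>. f (1/4 * (Z \<omega> \<bullet> (\<Sigma>' ** Z \<omega>))) \<partial>N)"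
    unfolding \<mu>_eq
    by (intro integral_distr Z borel_measurable_continuous_onI continuous_on_compose2[OF f(1)] continuous_intros) auto
  \<comment> \<open>The Frobenius product splits over columns, and left multiplication by
    \<open>\<Sigma>'\<close> acts on each column separately.\<close>
  also have "\<dots> = (\<integral>\<omega>. f (\<Sum>i\<in>UNIV. 1/4 * (column i (Z \<omega>) \<bullet> (\<Sigma>' *v column i (Z \<omega>)))) \<partial>N)"
    by (simp add: matrix_inner_columns column_matrix_mult sum_distrib_left)
  finally show "limsup (\<lambda>n. ereal (\<integral>\<omega>. ext_enn f (of_nat n * RWP n X \<omega> Hstar) \<partial>M))
          \<le> ereal (\<integral>\<omega>. f (\<Sum>i\<in>UNIV. 1/4 * (column i (Z \<omega> ) \<bullet>
                 (matrix_inv (second_moment Pstar) *v column i (Z \<omega>)))) \<partial>N)"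
    by (simp add: \<Sigma>'_def \<Sigma>_def)
qed

end
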